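(* Consider the linear model $Y=X\beta^*+w$ with $w\sim N(0,\sigma^2I_{n\times n})$ and a fixed design matrix $X\in\mathbb{R}^{n\times d}$. (a) Let $q\in(0,1]$ and consider a sequence of instances indexed by $n\to\infty$, with $d=d(n)$ and $R_q=R_q(n)>0$ satisfying $\frac{d}{R_qn^{q/2}}=\Omega(d^\kappa)$ for some $\kappa>0$. If $X$ is column-normalized, i.e. $\frac{1}{\sqrt n}\max_{j=1,\dots,d}\|X_j\|_2\le\kappa_c$ with $0<\kappa_c<\infty$, then for some constant $c_{2,q}$ (independent of $n,d,R_q,\sigma^2$ and $X$) there exist constants $c_1,c_2>0$ such that, for all sufficiently large $n$, there is an estimator $\hat\beta$ for which, with probability greater than $1-c_1\exp\big(-c_2R_q(\log d)^{1-q/2}n^{q/2}\big)$, $$\max_{\beta^*\in\mathbb{B}_q(R_q)}\frac1n\|X(\hat\beta-\beta^* )\|_2^2\le c_{2,q}\,\kappa_c^2\,R_q\Big[\frac{\sigma^2}{\kappa_c^2}\,\frac{\log d}{n}\Big]^{1-\frac q2}.$$ (b) Let $q=0$. For any $X$, there is an estimator $\hat\beta$ such that, with probability greater than $1-\exp(-10\,s\log(d/s))$, $$\max_{\beta^*\in\mathbb{B}_0(s)}\frac1n\|X(\hat\beta-\beta^* )\|_2^2\le 81\,\frac{\sigma^2\,s\log(d/s)}{n}.$$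
   Context: $X_j$ denotes the $j$-th column of $X$. For $q\in(0,1]$, $\mathbb{B}_q(R)=\{\beta\in\mathbb{R}^d:\sum_{j=1}^d|\beta_j|^q\le R\}$; $\mathbb{B}_0(s)=\{\beta\in\mathbb{R}^d:\sum_{j=1}^d\mathbb{I}[\beta_j\neq0]\le s\}$. An estimator is a measurable function $\hat\beta=\hat\beta(Y,X)\in\mathbb{R}^d$; in the displayed bounds $\hat\beta$ is evaluated at $Y=X\beta^*+w$ and the probability is over the noise $w$. The quantities $\sigma$ and $\kappa_c$ are positive constants, fixed along sequences of instances.
   Formalization: Part (b) is proved for s ≥ 1 with d ≥ 1.05 s. As stated it fails when s = d (n = d, X = I: the bound is 0, yet must hold with positive probability), and also for d/s ≤ 1.03 with s large. *)

theory Defs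
  imports "HOL-Probability.Probability" "HOL-Library.Landau_Symbols"
begin

text \<open>
  The dimensions vary along a sequence of instances, so a vector in \<open>\<real>\<^sup>m\<close> is an extensional function
  on \<open>{..<m}\<close> and an \<open>n \<times> d\<close> matrix an extensional function on \<open>{..<n} \<times> {..<d}\<close>, both with the
  product Borel sigma-algebra. Indices start at 0.
\<close>

definition vec_space :: "nat \<Rightarrow> (nat \<Rightarrow> real) measure" where
  "vec_space m = (\<Pi>\<^sub>M i\<in>{..<m}. borel)"

definition mat_space :: "nat \<Rightarrow> nat \<Rightarrow> (nat \<times> nat \<Rightarrow> real) measure" where
  "mat_space n d = (\<Pi>\<^sub>M ij\<in>{..<n} \<times> {..<d}. borel)"

definition vec_plus :: "nat \<Rightarrow> (nat \<Rightarrow> real) \<Rightarrow> (nat \<Rightarrow> real) \<Rightarrow> nat \<Rightarrow> real" where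
  "vec_plus m u v = (\<lambda>i\<in>{..<m}. u i + v i)"

definition vec_minus :: "nat \<Rightarrow> (nat \<Rightarrow> real) \<Rightarrow> (nat \<Rightarrow> real) \<Rightarrow> nat \<Rightarrow> real" where
  "vec_minus m u v = (\<lambda>i\<in>{..<m}. u i - v i)"

definition mat_vec :: "nat \<Rightarrow> nat \<Rightarrow> (nat \<times> nat \<Rightarrow> real) \<Rightarrow> (nat \<Rightarrow> real) \<Rightarrow> nat \<Rightarrow> real" where
  "mat_vec n d X \<beta> = (\<lambda>i\<in>{..<n}. \<Sum>j<d. X (i, j) * \<beta> j)"

definition l2_norm :: "nat \<Rightarrow> (nat \<Rightarrow> real) \<Rightarrow> real" where
  "l2_norm m v = L2_set v {..<m}"

definition column :: "nat \<Rightarrow> (nat \<times> nat \<Rightarrow> real) \<Rightarrow> nat \<Rightarrow> nat \<Rightarrow> real" where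
  "column n X j = (\<lambda>i\<in>{..<n}. X (i, j))"

text \<open>The maximum below is meaningful for \<open>d > 0\<close> only.\<close>

definition column_normalized :: "nat \<Rightarrow> nat \<Rightarrow> real \<Rightarrow> (nat \<times> nat \<Rightarrow> real) \<Rightarrow> bool" where
  "column_normalized n d \<kappa>\<^sub>c X \<longleftrightarrow>
     1 / sqrt (real n) * (MAX j\<in>{..<d}. l2_norm n (column n X j)) \<le> \<kappa>\<^sub>c"

definition lq_ball :: "real \<Rightarrow> nat \<Rightarrow> real \<Rightarrow> (nat \<Rightarrow> real) set" where
  "lq_ball q d R = {\<beta> \<in> space (vec_space d). (\<Sum>j<d. \<bar>\<beta> j\<bar> powr q) \<le> R}"

definition l0_ball :: "nat \<Rightarrow> nat \<Rightarrow> (nat \<Rightarrow> real) set" where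
  "l0_ball d s = {\<beta> \<in> space (vec_space d). (\<Sum>j<d. of_bool (\<beta> j \<noteq> 0)) \<le> s}"

text \<open>The law \<open>N(0, \<sigma>\<^sup>2 I)\<close> on \<open>\<real>\<^sup>n\<close>: independent centred coordinates with standard deviation \<open>\<sigma>\<close>.\<close>

definition gaussian_noise :: "nat \<Rightarrow> real \<Rightarrow> (nat \<Rightarrow> real) measure" where
  "gaussian_noise n \<sigma> = (\<Pi>\<^sub>M i\<in>{..<n}. density lborel (normal_density 0 \<sigma>))"

definition estimators ::
    "nat \<Rightarrow> nat \<Rightarrow> ((nat \<Rightarrow> real) \<times> (nat \<times> nat \<Rightarrow> real) \<Rightarrow> nat \<Rightarrow> real) set" where
  "estimators n d = measurable (vec_space n \<Otimes>\<^sub>M mat_space n d) (vec_space d)"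

text \<open>The error \<open>\<parallel>X(\<beta>' - \<beta>)\<parallel>\<^sup>2 / n\<close> of the estimate \<open>\<beta>'\<close> computed from \<open>Y = X\<beta> + w\<close>.\<close>

definition prediction_error ::
    "nat \<Rightarrow> nat \<Rightarrow> (nat \<times> nat \<Rightarrow> real)
       \<Rightarrow> ((nat \<Rightarrow> real) \<times> (nat \<times> nat \<Rightarrow> real) \<Rightarrow> nat \<Rightarrow> real)
       \<Rightarrow> (nat \<Rightarrow> real) \<Rightarrow> (nat \<Rightarrow> real) \<Rightarrow> real" where
  "prediction_error n d X est \<beta> w =
     1 / real n *
     (l2_norm n (mat_vec n d X (vec_minus d (est (vec_plus n (mat_vec n d X \<beta>) w, X)) \<beta>)))\<^sup>2"

text \<open>
  A condition quantified over an uncountable ball need not define a measurable set of noise vectors.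
  It holds with probability greater than \<open>p\<close> if it contains an event of probability greater
  than \<open>p\<close>; for a measurable condition this is the usual meaning.
\<close>

definition with_prob_greater :: "'a measure \<Rightarrow> real \<Rightarrow> ('a \<Rightarrow> bool) \<Rightarrow> bool" where
  "with_prob_greater M p P \<longleftrightarrow> (\<exists>E\<in>sets M. p < measure M E \<and> (\<forall>w\<in>E. P w))"

end

theory Submission
  imports Defs
begin

text \<open>
  Except in the last case below, the estimator is built from a countable set \<open>C\<close> of candidates that is dense in the parameter set,
  up to a resolution \<open>\<delta>\<close>, in the seminorm \<open>\<parallel>X \<beta>\<parallel>\<close>. If the noise satisfies
  \<open>\<langle>w, X(a - b)\<rangle> \<le> \<tau> \<parallel>X(a - b)\<parallel>\<close> for all candidates \<open>a\<close> and \<open>b\<close>, the candidates compatible with an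
  observation have diameter at most \<open>2 (\<tau> + \<delta>)\<close>, and the midpoint of an almost diametral pair is
  within about \<open>\<surd>3 (\<tau> + \<delta>)\<close> of each of them.

  For the \<open>\<ell>\<^sub>q\<close> balls, \<open>C\<close> is a finite grid of mesh \<open>t = (\<sigma> / \<kappa>\<^sub>c) \<surd>(ln d / n)\<close>: randomised rounding to
  multiples of \<open>t\<close> shows that points with \<open>O(R t\<^sup>-\<^sup>q)\<close> nonzero coordinates suffice, which bounds the
  metric entropy. Instances with bounded \<open>d\<close> are absorbed by the constant \<open>c\<^sub>1\<close>.

  For \<open>q = 0\<close> and \<open>d \<ge> 128 s\<close>, \<open>C\<close> consists of the rational \<open>s\<close>-sparse vectors, and the noise
  condition holds by a union bound over the chi-square tails of the column spans of \<open>2s\<close> columns.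
  For \<open>d < 128 s\<close> ordinary least squares is already good enough.
\<close>

subsection \<open>Inner products and orthonormal bases\<close>

definition ip :: "nat \<Rightarrow> (nat \<Rightarrow> real) \<Rightarrow> (nat \<Rightarrow> real) \<Rightarrow> real" where
  "ip n u v = (\<Sum>i<n. u i * v i)"

text \<open>\<open>mat_vec\<close> without the restriction to \<open>{..<n}\<close>: differences of
  fits are then plain lambda terms, and \<open>ip\<close> and \<open>l2_norm\<close> read only
  indices below \<open>n\<close>.\<close>

definition fit :: "nat \<Rightarrow> (nat \<times> nat \<Rightarrow> real) \<Rightarrow> (nat \<Rightarrow> real) \<Rightarrow> nat \<Rightarrow> real" where
  "fit d X \<beta> i = (\<Sum>j<d. X (i, j) * \<beta> j)"

lemma ip_commute: "ip n u v = ip n v u"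
  by (simp add: ip_def mult.commute)

lemma ip_add_left: "ip n (\<lambda>i. u i + v i) z = ip n u z + ip n v z"
  by (simp add: ip_def algebra_simps sum.distrib)

lemma ip_diff_left: "ip n (\<lambda>i. u i - v i) z = ip n u z - ip n v z"
  by (simp add: ip_def algebra_simps sum_subtractf)

lemma ip_scale_left: "ip n (\<lambda>i. c * u i) z = c * ip n u z"
  by (simp add: ip_def sum_distrib_left mult.assoc)

lemma ip_sum_left: "ip n (\<lambda>i. \<Sum>j\<in>S. u j i) z = (\<Sum>j\<in>S. ip n (u j) z)"
  unfolding ip_def by (simp add: sum_distrib_right) (rule sum.swap)

lemma ip_add_right: "ip n z (\<lambda>i. u i + v i) = ip n z u + ip n z v"
  by (simp add: ip_def algebra_simps sum.distrib)

lemma ip_diff_right: "ip n z (\<lambda>i. u i - v i) = ip n z u - ip n z v"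
  by (simp add: ip_def algebra_simps sum_subtractf)

lemma ip_scale_right: "ip n z (\<lambda>i. c * u i) = c * ip n z u"
  by (simp add: ip_def sum_distrib_left mult_ac)

lemma ip_sum_right: "ip n z (\<lambda>i. \<Sum>j\<in>S. u j i) = (\<Sum>j\<in>S. ip n z (u j))"
  using ip_sum_left[of n u S z] by (simp add: ip_commute)

lemma ip_cong:
  "(\<And>i. i < n \<Longrightarrow> u i = u' i) \<Longrightarrow> (\<And>i. i < n \<Longrightarrow> v i = v' i) \<Longrightarrow> ip n u v = ip n u' v'"
  by (simp add: ip_def)

lemma ip_self: "ip n u u = (l2_norm n u)\<^sup>2"
  by (simp add: ip_def l2_norm_def L2_set_def sum_nonneg power2_eq_square)

lemma l2_norm_nonneg [simp]: "0 \<le> l2_norm n u"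
  by (simp add: l2_norm_def)

lemma l2_norm_cong: "(\<And>i. i < n \<Longrightarrow> u i = v i) \<Longrightarrow> l2_norm n u = l2_norm n v"
  unfolding l2_norm_def by (rule L2_set_cong) auto

lemma l2_norm_triangle: "l2_norm n (\<lambda>i. u i + v i) \<le> l2_norm n u + l2_norm n v"
  unfolding l2_norm_def by (rule L2_set_triangle_ineq)

lemma l2_norm_minus_commute: "l2_norm n (\<lambda>i. u i - v i) = l2_norm n (\<lambda>i. v i - u i)"
  by (simp add: l2_norm_def L2_set_def power2_commute)

lemma ip_le_norms: "ip n u v \<le> l2_norm n u * l2_norm n v"
proof -
  have "ip n u v \<le> (\<Sum>i<n. \<bar>u i\<bar> * \<bar>v i\<bar>)"
    unfolding ip_def by (rule sum_mono) (metis abs_ge_self abs_mult)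
  also have "\<dots> \<le> l2_norm n u * l2_norm n v"
    unfolding l2_norm_def by (rule L2_set_mult_ineq)
  finally show ?thesis .
qed

lemma fit_diff: "fit d X (\<lambda>j. a j - b j) i = fit d X a i - fit d X b i"
  by (simp add: fit_def algebra_simps sum_subtractf)

lemma prediction_error_eq:
  "prediction_error n d X est \<beta> w =
     (l2_norm n (\<lambda>i. fit d X (est (vec_plus n (mat_vec n d X \<beta>) w, X)) i - fit d X \<beta> i))\<^sup>2 / real n"
proof -
  let ?b = "est (vec_plus n (mat_vec n d X \<beta>) w, X)"
  have "l2_norm n (mat_vec n d X (vec_minus d ?b \<beta>)) =
        l2_norm n (\<lambda>i. fit d X ?b i - fit d X \<beta> i)"
    by (rule l2_norm_cong)
       (simp add: mat_vec_def vec_minus_def fit_diff[symmetric], simp add: fit_def)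
  then show ?thesis by (simp add: prediction_error_def)
qed

lemma ip_orthonormal_sum:
  fixes e :: "nat \<Rightarrow> nat \<Rightarrow> real"
  assumes "\<And>k l. k < m \<Longrightarrow> l < m \<Longrightarrow> ip n (e k) (e l) = of_bool (k = l)"
  shows "ip n (\<lambda>i. \<Sum>l<m. f l * e l i) (\<lambda>i. \<Sum>l<m. f l * e l i) = (\<Sum>l<m. (f l)\<^sup>2)"
proof -
  have "ip n (\<lambda>i. \<Sum>l<m. f l * e l i) (\<lambda>i. \<Sum>l<m. f l * e l i)
      = (\<Sum>k<m. \<Sum>l<m. f k * (f l * ip n (e k) (e l)))"
    by (simp add: ip_sum_left ip_sum_right ip_scale_left ip_scale_right sum_distrib_left mult_ac)
  also have "\<dots> = (\<Sum>k<m. \<Sum>l<m. if l = k then (f k)\<^sup>2 else 0)"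
    by (intro sum.cong) (auto simp: assms power2_eq_square)
  finally show ?thesis by simp
qed

text \<open>Gram-Schmidt, one vector at a time; a vector with zero residual leaves the basis as it
  is. \<open>C\<close> expands the given vectors in the basis, which reduces the span to
  \<open>m\<close> coordinates; \<open>G\<close> goes back and later turns a projection into
  regression coefficients.\<close>

lemma orthonormal_basis_exists:
  fixes a :: "'j \<Rightarrow> nat \<Rightarrow> real"
  assumes "finite S"
  shows "\<exists>m e G C. m \<le> card S
      \<and> (\<forall>k<m. \<forall>l<m. ip n (e k) (e l) = of_bool (k = l))
      \<and> (\<forall>l<m. \<forall>i<n. e l i = (\<Sum>j\<in>S. G l j * a j i))
      \<and> (\<forall>j\<in>S. \<forall>i<n. a j i = (\<Sum>l<m. C j l * e l i))"
  using assms
proof (induction S)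
  case empty
  show ?case by (rule exI[of _ 0]) simp
next
  case (insert z S)
  from insert.IH obtain m e G C where IH: "m \<le> card S
      \<and> (\<forall>k<m. \<forall>l<m. ip n (e k) (e l) = of_bool (k = l))
      \<and> (\<forall>l<m. \<forall>i<n. e l i = (\<Sum>j\<in>S. G l j * a j i))
      \<and> (\<forall>j\<in>S. \<forall>i<n. a j i = (\<Sum>l<m. C j l * e l i))" by blast
  then have m: "m \<le> card S"
    and on: "\<And>k l. k < m \<Longrightarrow> l < m \<Longrightarrow> ip n (e k) (e l) = of_bool (k = l)"
    and eG: "\<And>l i. l < m \<Longrightarrow> i < n \<Longrightarrow> e l i = (\<Sum>j\<in>S. G l j * a j i)"
    and aC: "\<And>j i. j \<in> S \<Longrightarrow> i < n \<Longrightarrow> a j i = (\<Sum>l<m. C j l * e l i)" by blast+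
  define c where "c l = ip n (e l) (a z)" for l
  define r where "r i = a z i - (\<Sum>l<m. c l * e l i)" for i
  have r_eq: "r = (\<lambda>i. a z i - (\<Sum>l<m. c l * e l i))" by (simp add: r_def fun_eq_iff)
  have r_orth: "ip n (e k) r = 0" if "k < m" for k
  proof -
    have "ip n (e k) r = c k - (\<Sum>l<m. c l * ip n (e k) (e l))"
      unfolding r_eq by (simp add: ip_diff_right ip_sum_right ip_scale_right c_def)
    also have "(\<Sum>l<m. c l * ip n (e k) (e l)) = (\<Sum>l<m. if l = k then c k else 0)"
      by (rule sum.cong) (use on that in auto)
    finally show ?thesis using that by simp
  qed
  \<comment> \<open>The induction hypothesis says nothing about \<open>G l z\<close>, as
    \<open>z\<close> is not in \<open>S\<close>; these coefficients are reset to 0 before the sum is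
    extended to \<open>insert z S\<close>.\<close>
  define G' where "G' l j = (if j = z then 0 else G l j)" for l j
  have eG': "e l i = (\<Sum>j\<in>insert z S. G' l j * a j i)" if "l < m" "i < n" for l i
  proof -
    have "(\<Sum>j\<in>insert z S. G' l j * a j i) = (\<Sum>j\<in>S. G' l j * a j i)"
      using insert.hyps by (simp add: G'_def)
    also have "\<dots> = (\<Sum>j\<in>S. G l j * a j i)"
      by (rule sum.cong) (use insert.hyps in \<open>auto simp: G'_def\<close>)
    finally show ?thesis using eG that by simp
  qed
  show ?case
  proof (cases "l2_norm n r = 0")
    case True
    then have "\<forall>i<n. r i = 0"
      by (auto simp: l2_norm_def L2_set_eq_0_iff)
    then have az: "a z i = (\<Sum>l<m. c l * e l i)" if "i < n" for i
      using that by (simp add: r_def)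
    show ?thesis
    proof (rule exI[of _ m], rule exI[of _ e], rule exI[of _ G'], rule exI[of _ "C(z := c)"],
           intro conjI allI impI ballI)
      show "m \<le> card (insert z S)" using m insert.hyps by simp
    next
      fix j i assume "j \<in> insert z S" "i < n"
      then show "a j i = (\<Sum>l<m. (C(z := c)) j l * e l i)"
        using az aC by (cases "j = z") simp_all
    qed (use on eG' in blast)+
  next
    case False
    define \<rho> where "\<rho> = l2_norm n r"
    have \<rho>: "\<rho> \<noteq> 0" using False by (simp add: \<rho>_def)
    define e' where "e' = e(m := (\<lambda>i. 1 / \<rho> * r i))"
    have e'm: "e' m = (\<lambda>i. 1 / \<rho> * r i)" by (simp add: e'_def)
    have e'l: "e' l = e l" if "l < m" for l using that by (simp add: e'_def)
    \<comment> \<open>Coefficients of the residual: that of \<open>a z\<close> itself minus the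
      projection, rewritten in the given vectors through \<open>G'\<close>.\<close>
    define H where "H j = (if j = z then 1 else 0) - (\<Sum>l<m. c l * G' l j)" for j
    have r_G: "r i = (\<Sum>j\<in>insert z S. H j * a j i)" if "i < n" for i
    proof -
      have "(\<Sum>j\<in>insert z S. H j * a j i)
          = (\<Sum>j\<in>insert z S. (if j = z then a j i else 0))
            - (\<Sum>j\<in>insert z S. \<Sum>l<m. c l * (G' l j * a j i))"
        unfolding H_def sum_subtractf[symmetric]
        by (rule sum.cong) (auto simp: algebra_simps sum_distrib_left)
      also have "(\<Sum>j\<in>insert z S. \<Sum>l<m. c l * (G' l j * a j i))
          = (\<Sum>l<m. c l * (\<Sum>j\<in>insert z S. G' l j * a j i))"
        unfolding sum_distrib_left by (rule sum.swap)
      also have "\<dots> = (\<Sum>l<m. c l * e l i)"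
        by (rule sum.cong) (use eG' that in auto)
      finally show ?thesis using insert.hyps(1) by (simp add: r_def)
    qed
    show ?thesis
    proof (rule exI[of _ "Suc m"], rule exI[of _ e'], rule exI[of _ "G'(m := (\<lambda>j. 1 / \<rho> * H j))"],
           rule exI[of _ "\<lambda>j. if j = z then c(m := \<rho>) else (C j)(m := 0)"], intro conjI allI impI ballI)
      show "Suc m \<le> card (insert z S)" using m insert.hyps by simp
    next
      fix k l assume kl: "k < Suc m" "l < Suc m"
      have "ip n (e' m) (e' m) = 1"
        unfolding e'm ip_scale_left ip_scale_right ip_self \<rho>_def[symmetric]
        using \<rho> by (simp add: power2_eq_square)
      moreover have "ip n (e' m) (e' k) = 0" "ip n (e' k) (e' m) = 0" if "k < m" for k
        unfolding e'm e'l[OF that] ip_scale_left ip_scale_right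
        using r_orth[OF that] by (simp_all add: ip_commute)
      ultimately show "ip n (e' k) (e' l) = of_bool (k = l)"
        using kl on[of k l] by (cases "k < m"; cases "l < m") (auto simp: less_Suc_eq e'l)
    next
      fix l i assume "l < Suc m" and i: "i < n"
      then consider "l < m" | "l = m" by linarith
      then show "e' l i = (\<Sum>j\<in>insert z S. (G'(m := (\<lambda>j. 1 / \<rho> * H j))) l j * a j i)"
      proof cases
        case 1
        then show ?thesis using eG' i by (simp add: e'l)
      next
        case 2
        then show ?thesis using r_G[OF i]
          by (simp add: e'm sum_distrib_left mult.assoc del: sum.insert times_divide_eq_left)
      qed
    next
      fix j i assume j: "j \<in> insert z S" and i: "i < n"
      have *: "(\<Sum>l<m. f l * e' l i) = (\<Sum>l<m. f l * e l i)" for f :: "nat \<Rightarrow> real"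
        by (rule sum.cong) (auto simp: e'l)
      show "a j i = (\<Sum>l<Suc m. (if j = z then c(m := \<rho>) else (C j)(m := 0)) l * e' l i)"
        using j i aC \<rho> by (cases "j = z") (simp_all add: * e'm r_def)
    qed
  qed
qed

lemma ip_measurable [measurable]:
  "(\<lambda>w. ip n w u) \<in> borel_measurable (vec_space n)"
  unfolding ip_def vec_space_def by measurable

subsection \<open>Gaussian deviations on subspaces\<close>

lemma nn_integral_normal_density:
  "0 < \<sigma> \<Longrightarrow> (\<integral>\<^sup>+x. ennreal (normal_density \<mu> \<sigma> x) \<partial>lborel) = 1"
  using prob_space.emeasure_space_1[OF prob_space_normal_density[of \<sigma> \<mu>]]
  by (simp add: emeasure_density)

text \<open>Completing the square turns the integrand into a constant times the normal density with
  mean \<open>a * \<sigma>\<^sup>2\<close>.\<close>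

lemma nn_integral_gaussian_exp:
  assumes "0 < \<sigma>"
  shows "(\<integral>\<^sup>+x. ennreal (exp (a * x)) \<partial>density lborel (normal_density 0 \<sigma>))
       = ennreal (exp (a\<^sup>2 * \<sigma>\<^sup>2 / 2))"
proof -
  have "exp (a * x) * normal_density 0 \<sigma> x
      = exp (a\<^sup>2 * \<sigma>\<^sup>2 / 2) * normal_density (a * \<sigma>\<^sup>2) \<sigma> x" for x
  proof -
    have "a * x + - (x\<^sup>2) / (2 * \<sigma>\<^sup>2) = a\<^sup>2 * \<sigma>\<^sup>2 / 2 + - ((x - a * \<sigma>\<^sup>2)\<^sup>2) / (2 * \<sigma>\<^sup>2)"
      using assms by (simp add: field_simps power2_eq_square)
    then show ?thesis
      by (simp add: normal_density_def exp_add[symmetric])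
  qed
  then have "(\<integral>\<^sup>+x. ennreal (exp (a * x)) \<partial>density lborel (normal_density 0 \<sigma>))
      = (\<integral>\<^sup>+x. ennreal (exp (a\<^sup>2 * \<sigma>\<^sup>2 / 2)) * ennreal (normal_density (a * \<sigma>\<^sup>2) \<sigma> x) \<partial>lborel)"
    by (subst nn_integral_density) (auto simp: ennreal_mult[symmetric] mult.commute)
  also have "\<dots> = ennreal (exp (a\<^sup>2 * \<sigma>\<^sup>2 / 2))"
    using assms by (simp add: nn_integral_cmult nn_integral_normal_density)
  finally show ?thesis .
qed

text \<open>The rate is written as \<open>(1 - 1 / v\<^sup>2) / 2\<close> so that the tilted
  standard density is \<open>v\<close> times the normal density with standard deviation
  \<open>v\<close>; the moment is then \<open>v\<close> itself, without a square root.\<close>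

lemma nn_integral_gaussian_exp_square:
  assumes "1 \<le> v"
  shows "(\<integral>\<^sup>+x. ennreal (exp ((1 - 1 / v\<^sup>2) / 2 * x\<^sup>2)) \<partial>density lborel (normal_density 0 1))
       = ennreal v"
proof -
  have "exp ((1 - 1 / v\<^sup>2) / 2 * x\<^sup>2) * normal_density 0 1 x = v * normal_density 0 v x" for x
  proof -
    have "(1 - 1 / v\<^sup>2) / 2 * x\<^sup>2 + - (x\<^sup>2) / 2 = - (x\<^sup>2) / (2 * v\<^sup>2)"
      using assms by (simp add: field_simps)
    then show ?thesis
      using assms by (simp add: normal_density_def exp_add[symmetric] real_sqrt_mult)
  qed
  then have "(\<integral>\<^sup>+x. ennreal (exp ((1 - 1 / v\<^sup>2) / 2 * x\<^sup>2)) \<partial>density lborel (normal_density 0 1))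
      = (\<integral>\<^sup>+x. ennreal v * ennreal (normal_density 0 v x) \<partial>lborel)"
    using assms by (subst nn_integral_density) (auto simp: ennreal_mult[symmetric] mult.commute)
  also have "\<dots> = ennreal v"
    using assms by (simp add: nn_integral_cmult nn_integral_normal_density)
  finally show ?thesis .
qed

section \<open>Exponential moments of the noise vector\<close>

lemma sets_gaussian_noise [measurable_cong]: "sets (gaussian_noise n \<sigma>) = sets (vec_space n)"
  unfolding gaussian_noise_def vec_space_def by (rule sets_PiM_cong) auto

lemma product_prob_space_gaussian:
  "0 < \<sigma> \<Longrightarrow> product_prob_space (\<lambda>_. density lborel (normal_density 0 \<sigma>))"
  by (intro product_prob_spaceI prob_space_normal_density)

lemma prob_space_gaussian_noise: "0 < \<sigma> \<Longrightarrow> prob_space (gaussian_noise n \<sigma>)"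
  unfolding gaussian_noise_def by (intro prob_space_PiM prob_space_normal_density)

lemma nn_integral_gaussian_noise_prod:
  assumes "0 < \<sigma>" "\<And>i. f i \<in> borel_measurable borel"
  shows "(\<integral>\<^sup>+w. (\<Prod>i<n. f i (w i)) \<partial>gaussian_noise n \<sigma>)
       = (\<Prod>i<n. \<integral>\<^sup>+x. f i x \<partial>density lborel (normal_density 0 \<sigma>))"
proof -
  interpret product_prob_space "\<lambda>_::nat. density lborel (normal_density 0 \<sigma>)"
    by (rule product_prob_space_gaussian) fact
  show ?thesis
    unfolding gaussian_noise_def using assms by (intro product_nn_integral_prod) auto
qed

lemma nn_integral_gaussian_noise_exp:
  assumes "0 < \<sigma>"
  shows "(\<integral>\<^sup>+w. ennreal (exp (ip n w b)) \<partial>gaussian_noise n \<sigma>) = ennreal (exp (\<sigma>\<^sup>2 * ip n b b / 2))"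
proof -
  have "(\<integral>\<^sup>+w. ennreal (exp (ip n w b)) \<partial>gaussian_noise n \<sigma>)
      = (\<integral>\<^sup>+w. (\<Prod>i<n. ennreal (exp (b i * w i))) \<partial>gaussian_noise n \<sigma>)"
    by (simp add: ip_def exp_sum prod_ennreal mult.commute)
  also have "\<dots> = (\<Prod>i<n. ennreal (exp ((b i)\<^sup>2 * \<sigma>\<^sup>2 / 2)))"
    using assms by (subst nn_integral_gaussian_noise_prod) (auto simp: nn_integral_gaussian_exp)
  also have "\<dots> = ennreal (exp (\<Sum>i<n. (b i)\<^sup>2 * \<sigma>\<^sup>2 / 2))"
    by (simp add: exp_sum prod_ennreal)
  also have "(\<Sum>i<n. (b i)\<^sup>2 * \<sigma>\<^sup>2 / 2) = \<sigma>\<^sup>2 * ip n b b / 2"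
    by (simp add: ip_def sum_distrib_left sum_divide_distrib power2_eq_square mult_ac)
  finally show ?thesis .
qed

text \<open>The square in the exponent is linearised by an independent Gaussian vector \<open>g\<close>, after which
  the two integrations are interchanged; no rotation invariance is needed.\<close>

lemma nn_integral_exp_chi_square:
  assumes "0 < \<sigma>" "1 \<le> v"
    and on: "\<And>k l. k < m \<Longrightarrow> l < m \<Longrightarrow> ip n (e k) (e l) = of_bool (k = l)"
  shows "(\<integral>\<^sup>+w. ennreal (exp ((1 - 1 / v\<^sup>2) / (2 * \<sigma>\<^sup>2) * (\<Sum>l<m. (ip n w (e l))\<^sup>2))) \<partial>gaussian_noise n \<sigma>)
       = ennreal (v ^ m)"
proof -
  \<comment> \<open>With this scale, averaging the exponential of
    \<open>c * (\<Sum>l<m. g l * ip n w (e l))\<close> over a standard Gaussian \<open>g\<close>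
    gives the exponential of \<open>c\<^sup>2 / 2\<close> times the sum of squares, which is the
    required integrand.\<close>
  define c where "c = sqrt (1 - 1 / v\<^sup>2) / \<sigma>"
  have "0 \<le> 1 - 1 / v\<^sup>2" using assms(2) by (simp add: field_simps)
  then have c2: "c\<^sup>2 = (1 - 1 / v\<^sup>2) / \<sigma>\<^sup>2" by (simp add: c_def power_divide)
  let ?G = "gaussian_noise m 1" and ?W = "gaussian_noise n \<sigma>"
  let ?z = "\<lambda>w. (\<lambda>l. c * ip n w (e l))" and ?b = "\<lambda>g. (\<lambda>i. \<Sum>l<m. (c * g l) * e l i)"
  interpret W: prob_space ?W by (rule prob_space_gaussian_noise) fact
  interpret G: prob_space ?G by (rule prob_space_gaussian_noise) simp
  interpret P: pair_sigma_finite ?W ?G ..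
  have swap: "ip m g (?z w) = ip n w (?b g)" for g w
    unfolding ip_sum_right ip_scale_right by (simp add: ip_def[of m] mult_ac sum_distrib_left)
  have norm_b: "ip n (?b g) (?b g) = c\<^sup>2 * (\<Sum>l<m. (g l)\<^sup>2)" for g
    using ip_orthonormal_sum[OF on] by (simp add: power_mult_distrib sum_distrib_left)
  have "(\<integral>\<^sup>+w. ennreal (exp ((1 - 1 / v\<^sup>2) / (2 * \<sigma>\<^sup>2) * (\<Sum>l<m. (ip n w (e l))\<^sup>2))) \<partial>?W)
      = (\<integral>\<^sup>+w. \<integral>\<^sup>+g. ennreal (exp (ip m g (?z w))) \<partial>?G \<partial>?W)"
    unfolding nn_integral_gaussian_noise_exp[OF zero_less_one]
    by (rule nn_integral_cong, rule arg_cong[where f = "\<lambda>x. ennreal (exp x)"])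
       (simp add: ip_def[of m] power2_eq_square[symmetric] power_mult_distrib c2 sum_distrib_left sum_divide_distrib mult_ac)
  also have "\<dots> = (\<integral>\<^sup>+g. \<integral>\<^sup>+w. ennreal (exp (ip m g (?z w))) \<partial>?W \<partial>?G)"
  proof (rule P.Fubini'[symmetric])
    show "(\<lambda>(w, g). ennreal (exp (ip m g (?z w)))) \<in> borel_measurable (?W \<Otimes>\<^sub>M ?G)"
      unfolding ip_def[of m] ip_def[of n] gaussian_noise_def by measurable
  qed
  \<comment> \<open>Now \<open>w\<close> is integrated out first. By orthonormality
    \<open>?b g\<close> has squared norm \<open>c\<^sup>2 * (\<Sum>l<m. (g l)\<^sup>2)\<close>, and
    \<sigma> cancels against \<open>c\<close>, leaving independent scalar moments.\<close>
  also have "\<dots> = (\<integral>\<^sup>+g. ennreal (exp (\<sigma>\<^sup>2 * (c\<^sup>2 * (\<Sum>l<m. (g l)\<^sup>2)) / 2)) \<partial>?G)"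
    unfolding swap nn_integral_gaussian_noise_exp[OF assms(1)] norm_b ..
  also have "\<dots> = (\<integral>\<^sup>+g. (\<Prod>l<m. ennreal (exp ((1 - 1 / v\<^sup>2) / 2 * (g l)\<^sup>2))) \<partial>?G)"
    using assms(1)
    by (simp add: c2 prod_ennreal exp_sum[symmetric] sum_distrib_left sum_divide_distrib)
  also have "\<dots> = ennreal (v ^ m)"
    using assms(2)
    by (subst nn_integral_gaussian_noise_prod)
       (auto simp: nn_integral_gaussian_exp_square[simplified] prod_ennreal ennreal_power)
  finally show ?thesis .
qed

text \<open>Chernoff bound for the chi-square statistic \<open>Q\<close>, the squared norm of the
  projection of \<open>w\<close> onto the span. By Cauchy-Schwarz in the orthonormal basis, a single
  exceptional set serves all coefficient vectors \<open>c\<close> at once.\<close>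

lemma gaussian_subspace_deviation:
  fixes a :: "'j \<Rightarrow> nat \<Rightarrow> real"
  assumes "finite S" "0 < \<sigma>" "1 \<le> v" "0 \<le> \<tau>"
  shows "\<exists>N\<in>sets (gaussian_noise n \<sigma>).
      measure (gaussian_noise n \<sigma>) N \<le> v ^ card S * exp (- ((1 - 1 / v\<^sup>2) / (2 * \<sigma>\<^sup>2) * \<tau>\<^sup>2))
      \<and> (\<forall>w\<in>space (gaussian_noise n \<sigma>) - N. \<forall>c.
           ip n w (\<lambda>i. \<Sum>j\<in>S. c j * a j i) \<le> \<tau> * l2_norm n (\<lambda>i. \<Sum>j\<in>S. c j * a j i))"
proof -
  let ?W = "gaussian_noise n \<sigma>"
  interpret prob_space ?W by (rule prob_space_gaussian_noise) fact
  from orthonormal_basis_exists[OF assms(1), where n = n and a = a]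
  obtain m e G C where H: "m \<le> card S
      \<and> (\<forall>k<m. \<forall>l<m. ip n (e k) (e l) = of_bool (k = l))
      \<and> (\<forall>l<m. \<forall>i<n. e l i = (\<Sum>j\<in>S. G l j * a j i))
      \<and> (\<forall>j\<in>S. \<forall>i<n. a j i = (\<Sum>l<m. C j l * e l i))" by blast
  then have m: "m \<le> card S"
    and on: "\<And>k l. k < m \<Longrightarrow> l < m \<Longrightarrow> ip n (e k) (e l) = of_bool (k = l)"
    and aC: "\<And>j i. j \<in> S \<Longrightarrow> i < n \<Longrightarrow> a j i = (\<Sum>l<m. C j l * e l i)" by blast+
  define Q where "Q w = (\<Sum>l<m. (ip n w (e l))\<^sup>2)" for w
  define h where "h = (1 - 1 / v\<^sup>2) / (2 * \<sigma>\<^sup>2)"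
  have h: "0 \<le> h" using assms(2,3) by (simp add: h_def field_simps)
  have Q_meas [measurable]: "Q \<in> borel_measurable ?W" unfolding Q_def by measurable
  define N where "N = {w \<in> space ?W. 1 \<le> ennreal (exp (- (h * \<tau>\<^sup>2))) * ennreal (exp (h * Q w))}"
  have N_sets: "N \<in> sets ?W" unfolding N_def by measurable
  have "emeasure ?W N \<le> ennreal (exp (- (h * \<tau>\<^sup>2))) * (\<integral>\<^sup>+w. ennreal (exp (h * Q w)) \<partial>?W)"
    unfolding N_def
    by (rule order_trans[OF nn_integral_Markov_inequality])
       (auto intro!: mult_left_mono nn_integral_mono simp: indicator_def)
  also have "(\<integral>\<^sup>+w. ennreal (exp (h * Q w)) \<partial>?W) = ennreal (v ^ m)"
    unfolding h_def Q_def using assms(2,3) on by (rule nn_integral_exp_chi_square)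
  finally have "emeasure ?W N \<le> ennreal (exp (- (h * \<tau>\<^sup>2)) * v ^ m)"
    using assms(3) by (simp add: ennreal_mult)
  then have "measure ?W N \<le> exp (- (h * \<tau>\<^sup>2)) * v ^ m"
    using assms(3) by (simp add: emeasure_eq_measure)
  also have "\<dots> \<le> v ^ card S * exp (- (h * \<tau>\<^sup>2))"
    using power_increasing[OF m assms(3)] by (simp add: mult.commute)
  finally have meas: "measure ?W N \<le> v ^ card S * exp (- (h * \<tau>\<^sup>2))" .
  have "ip n w (\<lambda>i. \<Sum>j\<in>S. c j * a j i) \<le> \<tau> * l2_norm n (\<lambda>i. \<Sum>j\<in>S. c j * a j i)"
    if w: "w \<in> space ?W - N" for w c
  proof -
    \<comment> \<open>Outside \<open>N\<close> the inequality is strict. This excludes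
      \<open>h = 0\<close>, where \<open>N\<close> is the whole space, so \<open>h\<close> can be
      cancelled below.\<close>
    have "\<not> 0 \<le> h * Q w - h * \<tau>\<^sup>2"
      using w by (auto simp: N_def ennreal_mult[symmetric] exp_add[symmetric])
    then have "h * Q w < h * \<tau>\<^sup>2" by simp
    then have "Q w \<le> \<tau>\<^sup>2" using h by (metis linorder_not_le mult_left_mono less_imp_le)
    then have Q: "sqrt (Q w) \<le> \<tau>" using assms(4) by (simp add: real_le_lsqrt real_sqrt_le_iff)
    define f where "f l = (\<Sum>j\<in>S. c j * C j l)" for l
    let ?u = "\<lambda>i. \<Sum>l<m. f l * e l i"
    have u: "(\<Sum>j\<in>S. c j * a j i) = ?u i" if "i < n" for i
    proof -
      have "(\<Sum>j\<in>S. c j * a j i) = (\<Sum>j\<in>S. \<Sum>l<m. c j * C j l * e l i)"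
        by (rule sum.cong) (auto simp: aC that sum_distrib_left mult.assoc)
      then show ?thesis by (simp add: f_def sum_distrib_right) (rule sum.swap)
    qed
    have "ip n ?u ?u = (\<Sum>l<m. (f l)\<^sup>2)"
      by (rule ip_orthonormal_sum) (rule on)
    then have "ip n ?u ?u = (l2_norm m f)\<^sup>2"
      by (simp add: l2_norm_def L2_set_def sum_nonneg)
    then have norm_u: "l2_norm n ?u = l2_norm m f"
      by (simp add: ip_self)
    have "ip n w ?u = ip m (\<lambda>l. ip n w (e l)) f"
      by (simp add: ip_sum_right ip_scale_right) (simp add: ip_def mult_ac)
    also have "\<dots> \<le> sqrt (Q w) * l2_norm m f"
      by (rule order_trans[OF ip_le_norms]) (simp add: l2_norm_def L2_set_def Q_def)
    also have "\<dots> \<le> \<tau> * l2_norm n ?u" unfolding norm_u by (rule mult_right_mono) (use Q in auto)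
    finally show ?thesis
      using ip_cong[of n w w] l2_norm_cong[of n] u by (smt (verit, best))
  qed
  then show ?thesis
    using N_sets meas unfolding h_def by blast
qed

text \<open>Union bound over a family of spans. The instances are lines through differences of grid
  points, spans of \<open>2 * s\<close> columns, and the whole column space as a one-element
  family.\<close>

lemma gaussian_union_deviation:
  fixes a :: "'i \<Rightarrow> 'j \<Rightarrow> nat \<Rightarrow> real"
  assumes "finite I" "\<And>x. x \<in> I \<Longrightarrow> finite (S x)" "\<And>x. x \<in> I \<Longrightarrow> card (S x) \<le> k"
    and pos: "0 < \<sigma>" "1 \<le> v" "0 \<le> \<tau>"
  shows "\<exists>E\<in>sets (gaussian_noise n \<sigma>).
      1 - card I * (v ^ k * exp (- ((1 - 1 / v\<^sup>2) / (2 * \<sigma>\<^sup>2) * \<tau>\<^sup>2))) \<le> measure (gaussian_noise n \<sigma>) E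
      \<and> (\<forall>w\<in>E. \<forall>x\<in>I. \<forall>c.
           ip n w (\<lambda>i. \<Sum>j\<in>S x. c j * a x j i) \<le> \<tau> * l2_norm n (\<lambda>i. \<Sum>j\<in>S x. c j * a x j i))"
proof -
  let ?W = "gaussian_noise n \<sigma>"
  let ?p = "\<lambda>k. v ^ k * exp (- ((1 - 1 / v\<^sup>2) / (2 * \<sigma>\<^sup>2) * \<tau>\<^sup>2))"
  interpret prob_space ?W by (rule prob_space_gaussian_noise) fact
  have "\<forall>x\<in>I. \<exists>N. N \<in> sets ?W \<and> measure ?W N \<le> ?p (card (S x))
      \<and> (\<forall>w\<in>space ?W - N. \<forall>c.
           ip n w (\<lambda>i. \<Sum>j\<in>S x. c j * a x j i) \<le> \<tau> * l2_norm n (\<lambda>i. \<Sum>j\<in>S x. c j * a x j i))"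
    using gaussian_subspace_deviation[OF assms(2) pos] by blast
  from bchoice[OF this] obtain N where "\<forall>x\<in>I. N x \<in> sets ?W \<and> measure ?W (N x) \<le> ?p (card (S x))
      \<and> (\<forall>w\<in>space ?W - N x. \<forall>c.
           ip n w (\<lambda>i. \<Sum>j\<in>S x. c j * a x j i) \<le> \<tau> * l2_norm n (\<lambda>i. \<Sum>j\<in>S x. c j * a x j i))" ..
  then have N: "\<And>x. x \<in> I \<Longrightarrow> N x \<in> sets ?W" "\<And>x. x \<in> I \<Longrightarrow> measure ?W (N x) \<le> ?p (card (S x))"
    and dev: "\<And>x w c. x \<in> I \<Longrightarrow> w \<in> space ?W - N x \<Longrightarrow>
           ip n w (\<lambda>i. \<Sum>j\<in>S x. c j * a x j i) \<le> \<tau> * l2_norm n (\<lambda>i. \<Sum>j\<in>S x. c j * a x j i)"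
    by blast+
  have U: "(\<Union>x\<in>I. N x) \<in> sets ?W" using N(1) assms(1) by blast
  have "measure ?W (\<Union>x\<in>I. N x) \<le> (\<Sum>x\<in>I. measure ?W (N x))"
    using assms(1) N(1) by (intro finite_measure_subadditive_finite) auto
  also have "\<dots> \<le> (\<Sum>x\<in>I. ?p k)"
  proof (rule sum_mono)
    fix x assume "x \<in> I"
    then show "measure ?W (N x) \<le> ?p k"
      using N(2)[of x] power_increasing[OF assms(3)[of x] pos(2)] by (smt (verit) exp_ge_zero mult_right_mono)
  qed
  finally have "measure ?W (\<Union>x\<in>I. N x) \<le> card I * ?p k" by simp
  then have "1 - card I * ?p k \<le> measure ?W (space ?W - (\<Union>x\<in>I. N x))"
    using prob_compl[OF U] by simp
  moreover have "space ?W - (\<Union>x\<in>I. N x) \<in> sets ?W" using U by auto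
  ultimately show ?thesis using dev by (intro bexI[of _ "space ?W - (\<Union>x\<in>I. N x)"]) auto
qed

subsection \<open>Estimators\<close>

text \<open>The projection of \<open>y\<close> onto an orthonormal basis of the column space is
  pulled back to coefficients by \<open>G\<close>. The result is linear in \<open>y\<close>, hence
  measurable, and solves the normal equations even if the columns are dependent.\<close>

lemma least_squares_exists:
  "\<exists>g\<in>measurable (vec_space n) (vec_space d).
     \<forall>y \<delta>. ip n (\<lambda>i. y i - fit d X (g y) i) (fit d X \<delta>) = 0"
proof -
  from orthonormal_basis_exists[OF finite_lessThan[of d], where n = n and a = "\<lambda>j i. X (i, j)"]
  obtain m e G C where H: "m \<le> card {..<d}
      \<and> (\<forall>k<m. \<forall>l<m. ip n (e k) (e l) = of_bool (k = l))
      \<and> (\<forall>l<m. \<forall>i<n. e l i = (\<Sum>j<d. G l j * X (i, j)))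
      \<and> (\<forall>j\<in>{..<d}. \<forall>i<n. X (i, j) = (\<Sum>l<m. C j l * e l i))" by blast
  then have on: "\<And>k l. k < m \<Longrightarrow> l < m \<Longrightarrow> ip n (e k) (e l) = of_bool (k = l)"
    and eG: "\<And>l i. l < m \<Longrightarrow> i < n \<Longrightarrow> e l i = (\<Sum>j<d. G l j * X (i, j))"
    and XC: "\<And>j i. j < d \<Longrightarrow> i < n \<Longrightarrow> X (i, j) = (\<Sum>l<m. C j l * e l i)" by blast+
  define g where "g y = (\<lambda>j\<in>{..<d}. \<Sum>l<m. ip n y (e l) * G l j)" for y
  have "g \<in> measurable (vec_space n) (vec_space d)"
    unfolding g_def vec_space_def[of d]
    by (intro measurable_restrict borel_measurable_sum borel_measurable_times) (simp_all add: ip_measurable)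
  moreover have "ip n (\<lambda>i. y i - fit d X (g y) i) (fit d X \<delta>) = 0" for y \<delta>
  proof -
    let ?p = "\<lambda>i. \<Sum>l<m. ip n y (e l) * e l i"
    have g: "fit d X (g y) i = ?p i" if "i < n" for i
    proof -
      have "fit d X (g y) i = (\<Sum>j<d. \<Sum>l<m. ip n y (e l) * (G l j * X (i, j)))"
        by (simp add: fit_def g_def sum_distrib_left mult_ac)
      also have "\<dots> = (\<Sum>l<m. ip n y (e l) * (\<Sum>j<d. G l j * X (i, j)))"
        unfolding sum_distrib_left by (rule sum.swap)
      also have "\<dots> = ?p i" by (rule sum.cong) (use that eG in auto)
      finally show ?thesis .
    qed
    have "fit d X \<delta> i = (\<Sum>l<m. (\<Sum>j<d. \<delta> j * C j l) * e l i)" if "i < n" for i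
    proof -
      have "fit d X \<delta> i = (\<Sum>j<d. \<Sum>l<m. \<delta> j * C j l * e l i)"
        unfolding fit_def by (rule sum.cong) (use that in \<open>auto simp: XC sum_distrib_left mult_ac\<close>)
      then show ?thesis by (simp add: sum_distrib_right) (rule sum.swap)
    qed
    then have "ip n (\<lambda>i. y i - fit d X (g y) i) (fit d X \<delta>)
        = ip n (\<lambda>i. y i - ?p i) (\<lambda>i. \<Sum>l<m. (\<Sum>j<d. \<delta> j * C j l) * e l i)"
      using g by (intro ip_cong) auto
    also have "\<dots> = (\<Sum>l<m. (\<Sum>j<d. \<delta> j * C j l) * ip n (\<lambda>i. y i - ?p i) (e l))"
      by (simp add: ip_sum_right ip_scale_right)
    also have "\<dots> = 0"
    proof (rule sum.neutral, rule ballI)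
      fix l assume l: "l \<in> {..<m}"
      have "ip n ?p (e l) = (\<Sum>k<m. ip n y (e k) * ip n (e k) (e l))"
        by (simp add: ip_sum_left ip_scale_left)
      also have "\<dots> = (\<Sum>k<m. if k = l then ip n y (e l) else 0)"
        by (rule sum.cong) (use on l in auto)
      finally show "(\<Sum>j<d. \<delta> j * C j l) * ip n (\<lambda>i. y i - ?p i) (e l) = 0"
        using l by (simp add: ip_diff_left)
    qed
    finally show ?thesis .
  qed
  ultimately show ?thesis by blast
qed

text \<open>The design is fixed before the estimator is chosen, so the estimator may have
  \<open>X\<close> built in and ignore its matrix argument, which makes joint measurability
  immediate.\<close>

lemma estimatorI:
  "g \<in> measurable (vec_space n) (vec_space d) \<Longrightarrow> (\<lambda>yX. g (fst yX)) \<in> estimators n d"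
  unfolding estimators_def by (rule measurable_compose[OF measurable_fst])

section \<open>Midpoint estimation over a countable candidate set\<close>

lemma parallelogram_midpoint:
  "(l2_norm n (\<lambda>i. 1 / 2 * (a i + b i) - c i))\<^sup>2
     = ((l2_norm n (\<lambda>i. c i - a i))\<^sup>2 + (l2_norm n (\<lambda>i. c i - b i))\<^sup>2) / 2 - (l2_norm n (\<lambda>i. a i - b i))\<^sup>2 / 4"
  unfolding ip_self[symmetric] ip_def sum_divide_distrib sum.distrib[symmetric] sum_subtractf[symmetric]
  by (rule sum.cong) (simp_all add: field_simps)

text \<open>Two points of \<open>C\<close> that are compatible with the same observation lie within \<open>2 (\<tau> + \<delta>)\<close> of
  each other. Estimating by the midpoint of two compatible points at almost maximal distance,
  rather than by a compatible point, saves the factor \<open>3/4\<close> without which the constant 81 would be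
  out of reach.\<close>

lemma midpoint_estimator:
  fixes C :: "(nat \<Rightarrow> real) set"
  assumes C: "countable C" "C \<noteq> {}" "C \<subseteq> space (vec_space d)"
    and nonneg: "0 \<le> \<tau>" "0 \<le> \<delta>" "0 < \<eta>"
    and dense: "\<And>\<beta>. \<beta> \<in> B \<Longrightarrow> \<exists>a\<in>C. l2_norm n (\<lambda>i. fit d X \<beta> i - fit d X a i) \<le> \<delta>"
  shows "\<exists>est\<in>estimators n d. \<forall>\<beta>\<in>B. \<forall>w.
      (\<forall>a\<in>C. \<forall>b\<in>C. ip n w (\<lambda>i. fit d X a i - fit d X b i) \<le> \<tau> * l2_norm n (\<lambda>i. fit d X a i - fit d X b i)) \<longrightarrow>
      prediction_error n d X est \<beta> w \<le> (sqrt (3 * (\<tau> + \<delta>)\<^sup>2 + \<eta>) + \<delta>)\<^sup>2 / real n"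
proof -
  define F where "F = fit d X"
  define dist where "dist a b = l2_norm n (\<lambda>i. F a i - F b i)" for a b
  \<comment> \<open>The noise condition applied to the residual, with slack \<delta> for the
    distance between the true parameter and its approximating candidate. Only countably many pairs
    are tested, which keeps it measurable in \<open>y\<close>.\<close>
  define compat where "compat y c \<longleftrightarrow> (\<forall>a\<in>C. \<forall>b\<in>C.
      ip n (\<lambda>i. y i - F c i) (\<lambda>i. F a i - F b i) \<le> (\<tau> + \<delta>) * dist a b)" for y c
  define mid where "mid p = (\<lambda>j\<in>{..<d}. 1 / 2 * (fst p j + snd p j))" for p :: "(nat \<Rightarrow> real) \<times> (nat \<Rightarrow> real)"
  define f where "f = from_nat_into (C \<times> C)"
  define r where "r = sqrt (3 * (\<tau> + \<delta>)\<^sup>2 + \<eta>)"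
  define good where "good y k \<longleftrightarrow> (\<forall>c\<in>C. compat y c \<longrightarrow> dist (mid (f k)) c \<le> r)" for y k
  \<comment> \<open>Taking the first good index in an enumeration of the pairs is a measurable
    choice. If no candidate is compatible, every index is good.\<close>
  define g where "g y = mid (f (LEAST k. good y k))" for y
  have mid: "F (mid (a, b)) i = 1 / 2 * (F a i + F b i)" for a b i
    by (simp add: F_def fit_def mid_def sum_distrib_left sum.distrib[symmetric] sum_divide_distrib algebra_simps add_divide_distrib)
  have compat_meas: "Measurable.pred (vec_space n) (\<lambda>y. compat y c)" for c
    unfolding compat_def ip_diff_left pred_def
    by (intro sets.sets_Collect_countable_All' C(1)) measurable
  have "Measurable.pred (vec_space n) (\<lambda>y. good y k)" for k
    unfolding good_def pred_def
    by (intro sets.sets_Collect_countable_All' C(1) sets.sets_Collect_imp sets.sets_Collect_const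
          compat_meas[unfolded pred_def])
  then have "(\<lambda>y. LEAST k. good y k) \<in> measurable (vec_space n) (count_space UNIV)"
    by measurable
  moreover have "(\<lambda>k. mid (f k)) \<in> measurable (count_space UNIV) (vec_space d)"
    by (simp add: mid_def vec_space_def space_PiM)
  ultimately have g_meas: "g \<in> measurable (vec_space n) (vec_space d)"
    unfolding g_def by (rule measurable_compose)
  have compat_diam: "dist a b \<le> 2 * (\<tau> + \<delta>)" if "compat y a" "compat y b" "a \<in> C" "b \<in> C" for y a b
  proof (cases "dist a b = 0")
    case False
    \<comment> \<open>The tests at \<open>b\<close> in direction \<open>a - b\<close> and at
      \<open>a\<close> in direction \<open>b - a\<close> are added; the observation cancels.\<close>
    have "(dist a b)\<^sup>2 = ip n (\<lambda>i. y i - F b i) (\<lambda>i. F a i - F b i) + ip n (\<lambda>i. y i - F a i) (\<lambda>i. F b i - F a i)"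
      unfolding dist_def ip_self[symmetric] ip_diff_left ip_diff_right by simp
    also have "\<dots> \<le> (\<tau> + \<delta>) * dist a b + (\<tau> + \<delta>) * dist b a"
      using that unfolding compat_def by (intro add_mono) auto
    also have "\<dots> = 2 * (\<tau> + \<delta>) * dist a b"
      using l2_norm_minus_commute[of n "F a" "F b"] by (simp add: dist_def)
    finally have "dist a b * dist a b \<le> 2 * (\<tau> + \<delta>) * dist a b" by (simp only: power2_eq_square)
    moreover have "0 < dist a b" using False l2_norm_nonneg[of n] by (simp add: dist_def less_le)
    ultimately show ?thesis by (rule mult_right_le_imp_le)
  qed (use nonneg in simp)
  have good_exists: "\<exists>k. good y k" if c0: "c0 \<in> C" "compat y c0" for y c0
  proof -
    define T where "T = {(dist a b)\<^sup>2 | a b. a \<in> C \<and> b \<in> C \<and> compat y a \<and> compat y b}"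
    have diam_sq: "(dist a b)\<^sup>2 \<le> (2 * (\<tau> + \<delta>))\<^sup>2"
      if "a \<in> C" "b \<in> C" "compat y a" "compat y b" for a b
      by (rule power_mono[OF compat_diam]) (use that in \<open>simp_all add: dist_def\<close>)
    then have "bdd_above T" by (auto simp: T_def intro!: bdd_aboveI)
    moreover have "T \<noteq> {}" using c0 by (auto simp: T_def)
    \<comment> \<open>The supremum over a possibly infinite set need not be attained, hence the loss
      \<eta>.\<close>
    ultimately have "\<exists>t\<in>T. Sup T - \<eta> < t"
      using less_cSup_iff[of T "Sup T - \<eta>"] nonneg by auto
    then obtain a b where ab: "a \<in> C" "b \<in> C" "compat y a" "compat y b" and large: "Sup T - \<eta> < (dist a b)\<^sup>2"
      by (auto simp: T_def)
    obtain k where k: "f k = (a, b)"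
      using from_nat_into_surj[of "C \<times> C" "(a, b)"] C ab by (auto simp: f_def)
    have "dist (mid (a, b)) c \<le> r" if c: "c \<in> C" "compat y c" for c
    proof -
      have T: "(dist c x)\<^sup>2 \<le> Sup T" if "x \<in> C" "compat y x" for x
        by (rule cSup_upper) (use that c \<open>bdd_above T\<close> in \<open>auto simp: T_def\<close>)
      have "(dist a b)\<^sup>2 \<le> (2 * (\<tau> + \<delta>))\<^sup>2" using diam_sq ab by blast
      then have "(dist a b)\<^sup>2 \<le> 4 * (\<tau> + \<delta>)\<^sup>2" by (simp only: power_mult_distrib) simp
      moreover have "(dist (mid (a, b)) c)\<^sup>2 = ((dist c a)\<^sup>2 + (dist c b)\<^sup>2) / 2 - (dist a b)\<^sup>2 / 4"
        unfolding dist_def mid by (rule parallelogram_midpoint)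
      \<comment> \<open>Here \<open>p\<close> and \<open>q\<close> are the squared distances of
        \<open>c\<close> to \<open>a\<close> and \<open>b\<close>, \<open>x\<close> is that of
        \<open>a\<close> to \<open>b\<close>, and \<open>S\<close> is the supremum. The mean of
        \<open>p\<close> and \<open>q\<close> is below \<open>x + \<eta>\<close>, so
        \<open>z \<le> 3 / 4 * x + \<eta>\<close>.\<close>
      moreover have "z \<le> 3 * y + \<eta>"
        if "x \<le> 4 * y" "z = (p + q) / 2 - x / 4" "p \<le> S" "q \<le> S" "S - \<eta> < x" for x y z p q S :: real
        using that by argo
      ultimately have "(dist (mid (a, b)) c)\<^sup>2 \<le> 3 * (\<tau> + \<delta>)\<^sup>2 + \<eta>"
        using T[OF ab(1,3)] T[OF ab(2,4)] large by blast
      then show ?thesis unfolding r_def by (rule real_le_rsqrt)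
    qed
    then show ?thesis unfolding good_def using k by metis
  qed
  have "prediction_error n d X (\<lambda>yX. g (fst yX)) \<beta> w \<le> (r + \<delta>)\<^sup>2 / real n"
    if \<beta>: "\<beta> \<in> B" and w: "\<forall>a\<in>C. \<forall>b\<in>C. ip n w (\<lambda>i. F a i - F b i) \<le> \<tau> * dist a b" for \<beta> w
  proof -
    define y where "y = vec_plus n (mat_vec n d X \<beta>) w"
    obtain c where c: "c \<in> C" "l2_norm n (\<lambda>i. F \<beta> i - F c i) \<le> \<delta>"
      using dense[OF \<beta>] by (auto simp: F_def)
    have y: "y i - F c i = w i + (F \<beta> i - F c i)" if "i < n" for i
      using that by (simp add: y_def vec_plus_def mat_vec_def F_def fit_def)
    have "compat y c"
      unfolding compat_def
    proof (intro ballI)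
      fix a b assume ab: "a \<in> C" "b \<in> C"
      let ?u = "\<lambda>i. F a i - F b i"
      have "ip n (\<lambda>i. y i - F c i) ?u = ip n w ?u + ip n (\<lambda>i. F \<beta> i - F c i) ?u"
        unfolding ip_add_left[symmetric] using y by (intro ip_cong) auto
      also have "\<dots> \<le> \<tau> * dist a b + \<delta> * dist a b"
      proof (rule add_mono)
        show "ip n w ?u \<le> \<tau> * dist a b" using w ab by blast
        show "ip n (\<lambda>i. F \<beta> i - F c i) ?u \<le> \<delta> * dist a b"
          unfolding dist_def by (rule order_trans[OF ip_le_norms mult_right_mono]) (use c(2) in auto)
      qed
      finally show "ip n (\<lambda>i. y i - F c i) ?u \<le> (\<tau> + \<delta>) * dist a b" by (simp add: algebra_simps)
    qed
    then have "good y (LEAST k. good y k)"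
      using good_exists[OF c(1)] by (metis LeastI)
    then have "dist (g y) c \<le> r"
      using c \<open>compat y c\<close> by (auto simp: good_def g_def)
    moreover have "l2_norm n (\<lambda>i. F (g y) i - F \<beta> i) \<le> dist (g y) c + l2_norm n (\<lambda>i. F c i - F \<beta> i)"
      using l2_norm_triangle[of n "\<lambda>i. F (g y) i - F c i" "\<lambda>i. F c i - F \<beta> i"] by (simp add: dist_def)
    ultimately have "l2_norm n (\<lambda>i. F (g y) i - F \<beta> i) \<le> r + \<delta>"
      using c(2) l2_norm_minus_commute[of n "F c" "F \<beta>"] by simp
    then show ?thesis
      by (auto simp: prediction_error_eq F_def y_def intro!: divide_right_mono power_mono)
  qed
  then show ?thesis
    using estimatorI[OF g_meas] unfolding dist_def F_def r_def by blast
qed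

subsection \<open>Rounding and entropy of lq balls\<close>

text \<open>Randomised rounding of \<open>x\<close> to one of the two neighbouring integers: the mean is exact, and
  variance plus probability of a nonzero value is at most \<open>2 \<bar>x\<bar>\<^sup>q\<close>.\<close>

lemma integer_rounding_nonneg:
  fixes q x :: real
  assumes "0 < q" "q \<le> 1" "0 \<le> x"
  shows "\<exists>(k1::int) (k2::int) p. 0 \<le> p \<and> p \<le> 1 \<and> (1 - p) * (x - k1) + p * (x - k2) = 0
      \<and> (1 - p) * ((x - k1)\<^sup>2 + of_bool (k1 \<noteq> 0)) + p * ((x - k2)\<^sup>2 + of_bool (k2 \<noteq> 0)) \<le> 2 * \<bar>x\<bar> powr q
      \<and> \<bar>real_of_int k1\<bar> \<le> \<bar>x\<bar> + 1 \<and> \<bar>real_of_int k2\<bar> \<le> \<bar>x\<bar> + 1"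
proof -
  \<comment> \<open>The neighbours are the floor and the floor plus 1, the upper one taken with
    probability \<open>f\<close>.\<close>
  define f where "f = frac x"
  have f: "0 \<le> f" "f < 1" and x: "x = real_of_int \<lfloor>x\<rfloor> + f"
    using frac_lt_1[of x] by (simp_all add: f_def frac_def)
  have var: "(1 - f) * (x - \<lfloor>x\<rfloor>)\<^sup>2 + f * (x - (\<lfloor>x\<rfloor> + 1 :: int))\<^sup>2 = f * (1 - f)"
    using x by (simp add: f_def frac_def power2_eq_square algebra_simps)
  have small: "f * (1 - f) \<le> f" "f * (1 - f) \<le> 1"
    using f by (simp_all add: mult_left_le mult_le_one)
  \<comment> \<open>Below 1, variance and probability of a nonzero value are each at most
    \<open>x\<close>, hence at most \<open>x powr q\<close>; from 1 on, each is at most 1 and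
    \<open>1 \<le> x powr q\<close>.\<close>
  have "f * (1 - f) + ((1 - f) * of_bool (\<lfloor>x\<rfloor> \<noteq> 0) + f * of_bool (\<lfloor>x\<rfloor> + 1 \<noteq> 0)) \<le> 2 * \<bar>x\<bar> powr q"
  proof (cases "x < 1")
    case True
    then have 0: "\<lfloor>x\<rfloor> = 0" using assms(3) by linarith
    have "x \<le> x powr q"
      using powr_mono'[of q 1 x] assms True by (cases "x = 0") auto
    then show ?thesis using 0 small(1) x assms(3) by simp
  next
    case False
    then have "1 \<le> x powr q" using assms by (intro ge_one_powr_ge_zero) auto
    moreover have "(1 - f) * of_bool (\<lfloor>x\<rfloor> \<noteq> 0) + f * of_bool (\<lfloor>x\<rfloor> + 1 \<noteq> 0) \<le> (1 - f) * 1 + f * 1"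
      using f by (intro add_mono mult_left_mono) auto
    ultimately show ?thesis using small(2) assms(3) by simp
  qed
  then have "(1 - f) * ((x - \<lfloor>x\<rfloor>)\<^sup>2 + of_bool (\<lfloor>x\<rfloor> \<noteq> 0)) + f * ((x - (\<lfloor>x\<rfloor> + 1 :: int))\<^sup>2 + of_bool (\<lfloor>x\<rfloor> + 1 \<noteq> 0))
      \<le> 2 * \<bar>x\<bar> powr q"
    using var by (simp only: distrib_left)
  moreover have "(1 - f) * (x - \<lfloor>x\<rfloor>) + f * (x - (\<lfloor>x\<rfloor> + 1 :: int)) = 0"
    by (simp add: f_def frac_def algebra_simps)
  moreover have "\<bar>real_of_int \<lfloor>x\<rfloor>\<bar> \<le> \<bar>x\<bar> + 1"
    using assms(3) by linarith
  moreover have "\<bar>real_of_int (\<lfloor>x\<rfloor> + 1)\<bar> \<le> \<bar>x\<bar> + 1"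
    using assms(3) by linarith
  ultimately show ?thesis using f by (metis less_imp_le)
qed

lemma integer_rounding:
  fixes q x :: real
  assumes "0 < q" "q \<le> 1"
  shows "\<exists>(k1::int) (k2::int) p. 0 \<le> p \<and> p \<le> 1 \<and> (1 - p) * (x - k1) + p * (x - k2) = 0
      \<and> (1 - p) * ((x - k1)\<^sup>2 + of_bool (k1 \<noteq> 0)) + p * ((x - k2)\<^sup>2 + of_bool (k2 \<noteq> 0)) \<le> 2 * \<bar>x\<bar> powr q
      \<and> \<bar>real_of_int k1\<bar> \<le> \<bar>x\<bar> + 1 \<and> \<bar>real_of_int k2\<bar> \<le> \<bar>x\<bar> + 1"
proof (cases "0 \<le> x")
  case True
  then show ?thesis by (rule integer_rounding_nonneg[OF assms])
next
  case False
  then obtain k1 k2 :: int and p where H: "0 \<le> p" "p \<le> 1" "(1 - p) * (- x - k1) + p * (- x - k2) = 0"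
    "(1 - p) * ((- x - k1)\<^sup>2 + of_bool (k1 \<noteq> 0)) + p * ((- x - k2)\<^sup>2 + of_bool (k2 \<noteq> 0)) \<le> 2 * \<bar>- x\<bar> powr q"
    "\<bar>real_of_int k1\<bar> \<le> \<bar>- x\<bar> + 1" "\<bar>real_of_int k2\<bar> \<le> \<bar>- x\<bar> + 1"
    using integer_rounding_nonneg[OF assms, of "- x"] by auto
  have sq: "(x - real_of_int (- k))\<^sup>2 = (- x - real_of_int k)\<^sup>2" for k :: int
    by (simp add: power2_eq_square algebra_simps)
  have "(1 - p) * (x - (- k1 :: int)) + p * (x - (- k2 :: int)) = 0"
    using H(3) by (simp add: algebra_simps)
  moreover have "(1 - p) * ((x - (- k1 :: int))\<^sup>2 + of_bool (- k1 \<noteq> 0)) + p * ((x - (- k2 :: int))\<^sup>2 + of_bool (- k2 \<noteq> 0))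
      \<le> 2 * \<bar>x\<bar> powr q"
    using H(4) unfolding sq by simp
  moreover have "\<bar>real_of_int (- k1)\<bar> \<le> \<bar>x\<bar> + 1" "\<bar>real_of_int (- k2)\<bar> \<le> \<bar>x\<bar> + 1"
    using H(5,6) by simp_all
  ultimately show ?thesis using H(1,2) by blast
qed

text \<open>The roundings are chosen one coordinate at a time, keeping the potential (normalised squared
  error plus number of nonzero coordinates) below its conditional expectation.\<close>

lemma sparse_rounding:
  fixes x :: "nat \<Rightarrow> real" and c :: "nat \<Rightarrow> nat \<Rightarrow> real"
  assumes q: "0 < q" "q \<le> 1" and V: "0 < V" "\<And>j. j < m \<Longrightarrow> ip n (c j) (c j) \<le> V"
  shows "\<exists>k::nat \<Rightarrow> int.
      ip n (\<lambda>i. \<Sum>j<m. (x j - k j) * c j i) (\<lambda>i. \<Sum>j<m. (x j - k j) * c j i) / V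
        + real (card {j. j < m \<and> k j \<noteq> 0}) \<le> 2 * (\<Sum>j<m. \<bar>x j\<bar> powr q)
      \<and> (\<forall>j<m. \<bar>real_of_int (k j)\<bar> \<le> \<bar>x j\<bar> + 1)"
  using V(2)
proof (induction m)
  case 0
  show ?case by (simp add: ip_def)
next
  case (Suc m)
  then obtain k :: "nat \<Rightarrow> int" where
    k: "ip n (\<lambda>i. \<Sum>j<m. (x j - k j) * c j i) (\<lambda>i. \<Sum>j<m. (x j - k j) * c j i) / V
        + real (card {j. j < m \<and> k j \<noteq> 0}) \<le> 2 * (\<Sum>j<m. \<bar>x j\<bar> powr q)"
    and k_le: "\<forall>j<m. \<bar>real_of_int (k j)\<bar> \<le> \<bar>x j\<bar> + 1"
    by force
  obtain k1 k2 :: int and p where p: "0 \<le> p" "p \<le> 1"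
    and mean: "(1 - p) * (x m - k1) + p * (x m - k2) = 0"
    and pot: "(1 - p) * ((x m - k1)\<^sup>2 + of_bool (k1 \<noteq> 0)) + p * ((x m - k2)\<^sup>2 + of_bool (k2 \<noteq> 0))
        \<le> 2 * \<bar>x m\<bar> powr q"
    and k12: "\<bar>real_of_int k1\<bar> \<le> \<bar>x m\<bar> + 1" "\<bar>real_of_int k2\<bar> \<le> \<bar>x m\<bar> + 1"
    using integer_rounding[OF q] by blast
  define u where "u i = (\<Sum>j<m. (x j - k j) * c j i)" for i
  \<comment> \<open>The potential if coordinate \<open>m\<close> is rounded to \<open>l\<close>.
    Dividing by \<open>V\<close> makes the quadratic term of the new column at most
    \<open>(x m - l)\<^sup>2\<close>, which \<open>pot\<close> controls on average.\<close>
  define \<Phi> where "\<Phi> l = ip n (\<lambda>i. u i + (x m - real_of_int l) * c m i) (\<lambda>i. u i + (x m - real_of_int l) * c m i) / V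
      + (real (card {j. j < m \<and> k j \<noteq> 0}) + of_bool (l \<noteq> 0))" for l :: int
  have ip_cm: "ip n (c m) (c m) / V \<le> 1" using Suc.prems[of m] V(1) by simp
  have \<Phi>: "\<Phi> l \<le> ip n u u / V + 2 * (ip n u (c m) / V) * (x m - l) + (x m - l)\<^sup>2
      + (real (card {j. j < m \<and> k j \<noteq> 0}) + of_bool (l \<noteq> 0))" for l
  proof -
    have "ip n (\<lambda>i. u i + (x m - l) * c m i) (\<lambda>i. u i + (x m - l) * c m i)
        = ip n u u + 2 * ip n u (c m) * (x m - l) + (x m - l)\<^sup>2 * ip n (c m) (c m)"
      using ip_commute[of n "c m" u]
      unfolding ip_add_left ip_add_right ip_scale_left ip_scale_right
      by (simp add: power2_eq_square algebra_simps)
    moreover have "(x m - l)\<^sup>2 * (ip n (c m) (c m) / V) \<le> (x m - l)\<^sup>2"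
      using ip_cm by (intro mult_left_le) auto
    ultimately show ?thesis by (simp add: \<Phi>_def add_divide_distrib)
  qed
  have "(1 - p) * \<Phi> k1 + p * \<Phi> k2 \<le>
      (1 - p) * (ip n u u / V + 2 * (ip n u (c m) / V) * (x m - k1) + (x m - k1)\<^sup>2
        + (real (card {j. j < m \<and> k j \<noteq> 0}) + of_bool (k1 \<noteq> 0)))
      + p * (ip n u u / V + 2 * (ip n u (c m) / V) * (x m - k2) + (x m - k2)\<^sup>2
        + (real (card {j. j < m \<and> k j \<noteq> 0}) + of_bool (k2 \<noteq> 0)))"
    using p by (intro add_mono mult_left_mono \<Phi>) auto
  \<comment> \<open>The cross term is collected because it is multiplied by the mean rounding error,
    which is 0.\<close>
  also have "\<dots> = (ip n u u / V + real (card {j. j < m \<and> k j \<noteq> 0}))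
      + 2 * (ip n u (c m) / V) * ((1 - p) * (x m - k1) + p * (x m - k2))
      + ((1 - p) * ((x m - k1)\<^sup>2 + of_bool (k1 \<noteq> 0)) + p * ((x m - k2)\<^sup>2 + of_bool (k2 \<noteq> 0)))"
    by algebra
  also have "\<dots> \<le> 2 * (\<Sum>j<m. \<bar>x j\<bar> powr q) + 2 * \<bar>x m\<bar> powr q"
    using k pot mean by (simp add: u_def[abs_def])
  finally have avg: "(1 - p) * \<Phi> k1 + p * \<Phi> k2 \<le> 2 * (\<Sum>j<Suc m. \<bar>x j\<bar> powr q)" by simp
  have "\<exists>l. \<Phi> l \<le> 2 * (\<Sum>j<Suc m. \<bar>x j\<bar> powr q) \<and> \<bar>real_of_int l\<bar> \<le> \<bar>x m\<bar> + 1"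
  proof (rule ccontr)
    define b where "b = 2 * (\<Sum>j<Suc m. \<bar>x j\<bar> powr q)"
    assume "\<not> ?thesis"
    then have "b < \<Phi> k1" "b < \<Phi> k2" using k12 unfolding b_def by force+
    then have "b < (1 - p) * \<Phi> k1 + p * \<Phi> k2"
      using convex_bound_lt[of "- \<Phi> k1" "- b" "- \<Phi> k2" "1 - p" p] p by simp
    then show False using avg unfolding b_def by simp
  qed
  then obtain l where l: "\<Phi> l \<le> 2 * (\<Sum>j<Suc m. \<bar>x j\<bar> powr q)" "\<bar>real_of_int l\<bar> \<le> \<bar>x m\<bar> + 1" by blast
  define k' where "k' = k(m := l)"
  have "(\<Sum>j<Suc m. (x j - k' j) * c j i) = u i + (x m - l) * c m i" for i
    by (simp add: u_def k'_def)
  moreover have "{j. j < Suc m \<and> k' j \<noteq> 0} = {j. j < m \<and> k j \<noteq> 0} \<union> (if l \<noteq> 0 then {m} else {})"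
    by (auto simp: k'_def less_Suc_eq)
  then have "real (card {j. j < Suc m \<and> k' j \<noteq> 0}) = real (card {j. j < m \<and> k j \<noteq> 0}) + of_bool (l \<noteq> 0)"
    by (simp add: card_insert_if)
  moreover have "\<forall>j<Suc m. \<bar>real_of_int (k' j)\<bar> \<le> \<bar>x j\<bar> + 1"
    using k_le l(2) by (auto simp: k'_def less_Suc_eq)
  ultimately show ?case using l(1) unfolding \<Phi>_def by (intro exI[of _ k']) simp
qed

text \<open>After division by the mesh \<open>t\<close>, points of the ball have
  \<open>q\<close>-sum at most \<open>s\<close>. Rounding leaves at most \<open>2 * s\<close>
  nonzero integers, each of size at most \<open>s powr (1 / q) + 1\<close>, so the grid points are
  counted by listing positions and values.\<close>

lemma grid_net:
  assumes q: "0 < q" "q \<le> 1" and d: "0 < d" and t: "0 < t" and R: "0 < R"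
    and V: "0 < V" "\<And>j. j < d \<Longrightarrow> ip n (\<lambda>i. X (i, j)) (\<lambda>i. X (i, j)) \<le> V"
  defines "s \<equiv> R * t powr (- q)"
  shows "\<exists>C\<subseteq>space (vec_space d). finite C \<and> C \<noteq> {}
      \<and> real (card C) \<le> (real d * (2 * s powr (1 / q) + 3)) ^ nat \<lfloor>2 * s\<rfloor>
      \<and> (\<forall>\<beta>\<in>lq_ball q d R. \<exists>a\<in>C. (l2_norm n (\<lambda>i. fit d X \<beta> i - fit d X a i))\<^sup>2 \<le> 2 * V * t\<^sup>2 * s)"
proof -
  define A where "A = \<lfloor>s powr (1 / q)\<rfloor> + 1"
  define h where "h = nat \<lfloor>2 * s\<rfloor>"
  \<comment> \<open>Codewords have length exactly \<open>h\<close>, and \<open>map_of\<close> with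
    default 0 decodes them. Several words may give the same point; for an upper bound this is
    harmless.\<close>
  define L where "L = {xs :: (nat \<times> int) list. set xs \<subseteq> {..<d} \<times> {-A..A} \<and> length xs = h}"
  define val where "val xs j = (case map_of xs j of None \<Rightarrow> 0 | Some k \<Rightarrow> k)" for xs :: "(nat \<times> int) list" and j
  define vec where "vec xs = (\<lambda>j\<in>{..<d}. t * real_of_int (val xs j))" for xs
  have s: "0 < s" using R t by (simp add: s_def)
  have "0 \<le> \<lfloor>s powr (1 / q)\<rfloor>" by simp
  then have A: "0 < A" by (simp add: A_def)
  have finL: "finite L" unfolding L_def by (rule finite_lists_length_eq) auto
  have "real (card (vec ` L)) \<le> real (card L)"
    using card_image_le[OF finL] by simp
  also have "card L = (d * nat (2 * A + 1)) ^ h"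
    unfolding L_def by (subst card_lists_length_eq) (simp_all add: card_cartesian_product algebra_simps)
  also have "real \<dots> = (real d * real_of_int (2 * A + 1)) ^ h" using A by simp
  also have "\<dots> \<le> (real d * (2 * s powr (1 / q) + 3)) ^ h"
    using A by (intro power_mono mult_left_mono) (simp_all add: A_def)
  finally have card: "real (card (vec ` L)) \<le> (real d * (2 * s powr (1 / q) + 3)) ^ h" .
  have "replicate h (0, 0) \<in> L" using d A by (auto simp: L_def)
  then have ne: "vec ` L \<noteq> {}" by blast
  have "\<exists>a\<in>vec ` L. (l2_norm n (\<lambda>i. fit d X \<beta> i - fit d X a i))\<^sup>2 \<le> 2 * V * t\<^sup>2 * s"
    if \<beta>: "\<beta> \<in> lq_ball q d R" for \<beta>
  proof -
    define x where "x j = \<beta> j / t" for j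
    have x_sum: "(\<Sum>j<d. \<bar>x j\<bar> powr q) \<le> s"
    proof -
      have "(\<Sum>j<d. \<bar>x j\<bar> powr q) = (\<Sum>j<d. \<bar>\<beta> j\<bar> powr q) * t powr (- q)"
        unfolding x_def sum_distrib_right
        by (rule sum.cong) (use t in \<open>simp_all add: abs_divide powr_divide powr_minus_divide\<close>)
      also have "\<dots> \<le> s"
        using \<beta> unfolding s_def lq_ball_def by (intro mult_right_mono) auto
      finally show ?thesis .
    qed
    have x_le: "\<bar>x j\<bar> \<le> s powr (1 / q)" if "j < d" for j
    proof -
      have "\<bar>x j\<bar> powr q \<le> (\<Sum>j<d. \<bar>x j\<bar> powr q)"
        using that by (intro member_le_sum) auto
      then have "(\<bar>x j\<bar> powr q) powr (1 / q) \<le> s powr (1 / q)"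
        using x_sum q by (intro powr_mono2) auto
      then show ?thesis using q by (simp add: powr_powr)
    qed
    obtain k :: "nat \<Rightarrow> int" where
      k: "ip n (\<lambda>i. \<Sum>j<d. (x j - k j) * X (i, j)) (\<lambda>i. \<Sum>j<d. (x j - k j) * X (i, j)) / V
        + real (card {j. j < d \<and> k j \<noteq> 0}) \<le> 2 * (\<Sum>j<d. \<bar>x j\<bar> powr q)"
      and k_le: "\<forall>j<d. \<bar>real_of_int (k j)\<bar> \<le> \<bar>x j\<bar> + 1"
      using sparse_rounding[OF q V(1), of d n "\<lambda>j i. X (i, j)" x] V(2) by blast
    define J where "J = {j. j < d \<and> k j \<noteq> 0}"
    have ip0: "0 \<le> ip n u u" for u by (simp add: ip_self)
    have "real (card J) \<le> 2 * s"
      using k x_sum V(1) ip0 divide_nonneg_pos[OF ip0 V(1)] unfolding J_def by (smt (verit))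
    then have J: "card J \<le> h" unfolding h_def by (simp add: le_nat_floor)
    have err: "ip n (\<lambda>i. \<Sum>j<d. (x j - k j) * X (i, j)) (\<lambda>i. \<Sum>j<d. (x j - k j) * X (i, j)) \<le> 2 * s * V"
      using k x_sum V(1) by (simp add: field_simps) (smt (verit) mult_left_mono mult_nonneg_nonneg of_nat_0_le_iff)
    have k_range: "k j \<in> {-A..A}" if "j < d" for j
    proof -
      have "\<bar>real_of_int (k j)\<bar> \<le> s powr (1 / q) + 1" using k_le x_le[OF that] that by force
      then have "\<bar>k j\<bar> \<le> A" unfolding A_def by linarith
      then show ?thesis by auto
    qed
    \<comment> \<open>The support is padded with index 0, a valid position because
      \<open>0 < d\<close>. Repetitions do no harm: an index is always paired with the same
      value.\<close>
    define js where "js = sorted_list_of_set J @ replicate (h - card J) 0"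
    define xs where "xs = map (\<lambda>j. (j, k j)) js"
    have finJ: "finite J" by (simp add: J_def)
    have js: "set js \<subseteq> {..<d}" "J \<subseteq> set js" "length js = h"
      using J finJ d by (auto simp: js_def J_def)
    have "xs \<in> L" using js k_range by (auto simp: L_def xs_def)
    have "val xs j = k j" if "j < d" for j
    proof (cases "j \<in> set js")
      case True
      then show ?thesis by (simp add: val_def xs_def map_of_map_restrict)
    next
      case False
      then have "k j = 0" using js(2) that by (auto simp: J_def)
      then show ?thesis using False by (simp add: val_def xs_def map_of_map_restrict)
    qed
    then have "fit d X \<beta> i - fit d X (vec xs) i = t * (\<Sum>j<d. (x j - k j) * X (i, j))" for i
      using t by (simp add: fit_def vec_def x_def sum_subtractf[symmetric] sum_distrib_left algebra_simps)
    then have "(l2_norm n (\<lambda>i. fit d X \<beta> i - fit d X (vec xs) i))\<^sup>2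
        = t\<^sup>2 * ip n (\<lambda>i. \<Sum>j<d. (x j - k j) * X (i, j)) (\<lambda>i. \<Sum>j<d. (x j - k j) * X (i, j))"
      by (simp only: ip_self[symmetric] ip_scale_left ip_scale_right) (simp add: power2_eq_square)
    also have "\<dots> \<le> t\<^sup>2 * (2 * s * V)" using err by (rule mult_left_mono) simp
    finally show ?thesis using \<open>xs \<in> L\<close> by (auto simp: mult_ac)
  qed
  moreover have "vec ` L \<subseteq> space (vec_space d)"
    by (intro image_subsetI) (simp add: vec_def vec_space_def space_PiM)
  ultimately show ?thesis using card ne finL unfolding h_def by blast
qed

section \<open>Risk bounds over lq balls\<close>

lemma column_normalized_ip:
  assumes "column_normalized n d \<kappa> X" "0 < n" "j < d"
  shows "ip n (\<lambda>i. X (i, j)) (\<lambda>i. X (i, j)) \<le> n * \<kappa>\<^sup>2"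
proof -
  have "l2_norm n (column n X j) \<le> (MAX j\<in>{..<d}. l2_norm n (column n X j))"
    using assms(3) by (intro Max_ge) auto
  also have "\<dots> \<le> sqrt n * \<kappa>"
    using assms(1,2) by (simp add: column_normalized_def field_simps)
  finally have "(l2_norm n (column n X j))\<^sup>2 \<le> (sqrt n * \<kappa>)\<^sup>2"
    by (intro power_mono) auto
  moreover have "ip n (\<lambda>i. X (i, j)) (\<lambda>i. X (i, j)) = (l2_norm n (column n X j))\<^sup>2"
    unfolding ip_self[symmetric] by (rule ip_cong) (simp_all add: column_def)
  ultimately show ?thesis by (simp add: power_mult_distrib)
qed

text \<open>With this mesh the metric entropy and the squared approximation error in units of
  \<open>\<sigma>\<^sup>2\<close> are both of order \<open>s * ln d\<close>, so the union bound over
  pairs of grid points costs only a constant factor in the radius.\<close>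

lemma lq_ball_estimation:
  fixes n d :: nat and q \<sigma> \<kappa> R s :: real
  defines "s \<equiv> R * (\<sigma> / \<kappa> * sqrt (ln d / n)) powr (- q)"
  assumes q: "0 < q" "q \<le> 1" and pos: "0 < \<sigma>" "0 < \<kappa>" "0 < n" "0 < R"
    and d: "5 \<le> d" "s \<le> d" and X: "column_normalized n d \<kappa> X"
  shows "\<exists>est\<in>estimators n d. with_prob_greater (gaussian_noise n \<sigma>)
      (1 - 3 * exp (- (2 * (2 + 1 / q) * (s * ln d))))
      (\<lambda>w. \<forall>\<beta>\<in>lq_ball q d R. prediction_error n d X est \<beta> w
          \<le> 2 * (2 * sqrt (8 * (2 + 1 / q)) + 3)\<^sup>2 * (\<sigma>\<^sup>2 * s * ln d / n))"
proof -
  let ?W = "gaussian_noise n \<sigma>"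
  define t where "t = \<sigma> / \<kappa> * sqrt (ln d / n)"
  define V where "V = n * \<kappa>\<^sup>2"
  have ln_d: "0 < ln (real d)" using d(1) by simp
  have t: "0 < t" using pos ln_d by (simp add: t_def)
  have s: "0 < s" using pos(4) t unfolding s_def t_def[symmetric] by simp
  have V: "0 < V" using pos by (simp add: V_def)
  have Vt: "V * t\<^sup>2 = \<sigma>\<^sup>2 * ln d"
    using pos ln_d by (simp add: V_def t_def power_mult_distrib power_divide)
  have s_eq: "s = R * t powr (- q)" unfolding s_def t_def ..
  have "\<exists>C\<subseteq>space (vec_space d). finite C \<and> C \<noteq> {}
      \<and> real (card C) \<le> (real d * (2 * s powr (1 / q) + 3)) ^ nat \<lfloor>2 * s\<rfloor>
      \<and> (\<forall>\<beta>\<in>lq_ball q d R. \<exists>a\<in>C. (l2_norm n (\<lambda>i. fit d X \<beta> i - fit d X a i))\<^sup>2 \<le> 2 * V * t\<^sup>2 * s)"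
    unfolding s_eq
    by (rule grid_net[OF q _ t pos(4) V])
       (use d(1) in simp, unfold V_def, rule column_normalized_ip[OF X pos(3)])
  then obtain C where C: "C \<subseteq> space (vec_space d)" "finite C" "C \<noteq> {}"
    and card: "real (card C) \<le> (real d * (2 * s powr (1 / q) + 3)) ^ nat \<lfloor>2 * s\<rfloor>"
    and dense: "\<And>\<beta>. \<beta> \<in> lq_ball q d R \<Longrightarrow>
        \<exists>a\<in>C. (l2_norm n (\<lambda>i. fit d X \<beta> i - fit d X a i))\<^sup>2 \<le> 2 * V * t\<^sup>2 * s"
    by blast
  \<comment> \<open>\<open>B\<close> bounds the logarithm of the number of grid points, \<delta> is
    the resolution of the grid, and \<open>g\<close> is chosen such that the deviation exponent at
    threshold \<open>g * \<delta>\<close> is \<open>3 * B\<close>: pairs cost \<open>2 * B\<close>,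
    and one \<open>B\<close> remains.\<close>
  define B where "B = 2 * (2 + 1 / q) * (s * ln d)"
  define \<delta> where "\<delta> = sqrt (2 * (\<sigma>\<^sup>2 * s * ln d))"
  define g where "g = sqrt (8 * (2 + 1 / q))"
  have \<delta>: "0 < \<delta>" "\<delta>\<^sup>2 = 2 * (\<sigma>\<^sup>2 * s * ln d)" using pos s ln_d by (simp_all add: \<delta>_def)
  have g: "0 \<le> g" "g\<^sup>2 = 8 * (2 + 1 / q)" using q by (simp_all add: g_def)
  have "real (card C) \<le> exp B"
  proof -
    have "s powr (1 / q) \<le> d powr (1 / q)" using s d q by (intro powr_mono2) auto
    moreover have "1 \<le> real d powr (1 / q)" using d q by (intro ge_one_powr_ge_zero) auto
    \<comment> \<open>Here \<open>s \<le> d\<close> and, in the next step, \<open>5 \<le> d\<close>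
      enter: each position-value pair contributes a factor of at most
      \<open>d powr (2 + 1 / q)\<close>.\<close>
    ultimately have "2 * s powr (1 / q) + 3 \<le> 5 * d powr (1 / q)" by simp
    also have "\<dots> \<le> d * d powr (1 / q)" using d by (intro mult_right_mono) auto
    finally have "real d * (2 * s powr (1 / q) + 3) \<le> d * (d * d powr (1 / q))"
      by (rule mult_left_mono) simp
    also have "\<dots> = exp ((2 + 1 / q) * ln d)"
      using d by (simp add: powr_def distrib_right exp_add mult_exp_exp power2_eq_square exp_double)
    finally have "real d * (2 * s powr (1 / q) + 3) \<le> exp ((2 + 1 / q) * ln d)" .
    then have "real (card C) \<le> exp ((2 + 1 / q) * ln d) ^ nat \<lfloor>2 * s\<rfloor>"
      using s by (intro order_trans[OF card] power_mono) auto
    also have "\<dots> = exp (real (nat \<lfloor>2 * s\<rfloor>) * ((2 + 1 / q) * ln d))"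
      by (simp add: exp_of_nat_mult)
    also have "\<dots> \<le> exp (2 * s * ((2 + 1 / q) * ln d))"
      using s q ln_d by (intro exp_le_cancel_iff[THEN iffD2] mult_right_mono) auto
    finally show ?thesis by (simp add: B_def mult_ac)
  qed
  then have "real (card C) * real (card C) \<le> exp B * exp B"
    by (intro mult_mono) auto
  then have card2: "real (card (C \<times> C)) \<le> exp (2 * B)"
    by (simp add: card_cartesian_product exp_double power2_eq_square)
  \<comment> \<open>Each difference of fits spans a line, indexed by the unit type; with
    \<open>v = 2\<close> its dimension costs a factor 2.\<close>
  have "\<exists>E\<in>sets ?W. 1 - card (C \<times> C) * (2 ^ 1 * exp (- ((1 - 1 / 2\<^sup>2) / (2 * \<sigma>\<^sup>2) * (g * \<delta>)\<^sup>2))) \<le> measure ?W E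
      \<and> (\<forall>w\<in>E. \<forall>x\<in>C \<times> C. \<forall>c.
       ip n w (\<lambda>i. \<Sum>j\<in>{()}. c j * (fit d X (fst x) i - fit d X (snd x) i))
         \<le> g * \<delta> * l2_norm n (\<lambda>i. \<Sum>j\<in>{()}. c j * (fit d X (fst x) i - fit d X (snd x) i)))"
    by (rule gaussian_union_deviation) (use C(2) pos(1) \<delta>(1) g(1) in simp_all)
  then obtain E where E: "E \<in> sets ?W"
    and prob: "1 - card (C \<times> C) * (2 ^ 1 * exp (- ((1 - 1 / 2\<^sup>2) / (2 * \<sigma>\<^sup>2) * (g * \<delta>)\<^sup>2))) \<le> measure ?W E"
    and dev: "\<forall>w\<in>E. \<forall>x\<in>C \<times> C. \<forall>c.
       ip n w (\<lambda>i. \<Sum>j\<in>{()}. c j * (fit d X (fst x) i - fit d X (snd x) i))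
         \<le> g * \<delta> * l2_norm n (\<lambda>i. \<Sum>j\<in>{()}. c j * (fit d X (fst x) i - fit d X (snd x) i))"
    by blast
  have expo: "(1 - 1 / 2\<^sup>2) / (2 * \<sigma>\<^sup>2) * (g * \<delta>)\<^sup>2 = 3 * B"
    using pos(1) unfolding power_mult_distrib g(2) \<delta>(2) B_def by (simp add: field_simps)
  have "card (C \<times> C) * (2 ^ 1 * exp (- (3 * B))) \<le> exp (2 * B) * (2 * exp (- (3 * B)))"
    using card2 by (intro mult_mono) auto
  also have "\<dots> = 2 * exp (- B)" by (simp add: exp_add[symmetric])
  \<comment> \<open>Rounding 2 up to 3 makes the probability bound strict.\<close>
  also have "\<dots> < 3 * exp (- B)" by simp
  finally have "1 - 3 * exp (- B) < measure ?W E" using prob unfolding expo by linarith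
  obtain est where est: "est \<in> estimators n d"
    and err: "\<forall>\<beta>\<in>lq_ball q d R. \<forall>w.
      (\<forall>a\<in>C. \<forall>b\<in>C. ip n w (\<lambda>i. fit d X a i - fit d X b i) \<le> g * \<delta> * l2_norm n (\<lambda>i. fit d X a i - fit d X b i)) \<longrightarrow>
      prediction_error n d X est \<beta> w \<le> (sqrt (3 * (g * \<delta> + \<delta>)\<^sup>2 + \<delta>\<^sup>2) + \<delta>)\<^sup>2 / real n"
  proof -
    have "\<exists>a\<in>C. l2_norm n (\<lambda>i. fit d X \<beta> i - fit d X a i) \<le> \<delta>" if \<beta>: "\<beta> \<in> lq_ball q d R" for \<beta>
    proof -
      have "2 * V * t\<^sup>2 * s = \<delta>\<^sup>2" using Vt unfolding \<delta>(2) by (simp add: mult_ac)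
      with dense[OF \<beta>] obtain a where a: "a \<in> C"
        and le: "(l2_norm n (\<lambda>i. fit d X \<beta> i - fit d X a i))\<^sup>2 \<le> \<delta>\<^sup>2" by metis
      show ?thesis using a power2_le_imp_le[OF le] \<delta>(1) by (meson less_imp_le)
    qed
    then have "\<exists>est\<in>estimators n d. \<forall>\<beta>\<in>lq_ball q d R. \<forall>w.
      (\<forall>a\<in>C. \<forall>b\<in>C. ip n w (\<lambda>i. fit d X a i - fit d X b i) \<le> g * \<delta> * l2_norm n (\<lambda>i. fit d X a i - fit d X b i)) \<longrightarrow>
      prediction_error n d X est \<beta> w \<le> (sqrt (3 * (g * \<delta> + \<delta>)\<^sup>2 + \<delta>\<^sup>2) + \<delta>)\<^sup>2 / real n"
      using C \<delta>(1) g(1) by (intro midpoint_estimator) (simp_all add: countable_finite)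
    then show ?thesis using that by blast
  qed
  have bound: "(sqrt (3 * (g * \<delta> + \<delta>)\<^sup>2 + \<delta>\<^sup>2) + \<delta>)\<^sup>2 / n \<le> 2 * (2 * g + 3)\<^sup>2 * (\<sigma>\<^sup>2 * s * ln d / n)"
  proof -
    \<comment> \<open>With \<open>\<eta> = \<delta>\<^sup>2\<close> the radius is at most
      \<open>2 * (g + 1) * \<delta>\<close>; adding \<delta> gives the factor
      \<open>2 * g + 3\<close>.\<close>
    have "\<delta>\<^sup>2 \<le> (g * \<delta> + \<delta>)\<^sup>2" using \<delta> g by (intro power_mono) auto
    then have "sqrt (3 * (g * \<delta> + \<delta>)\<^sup>2 + \<delta>\<^sup>2) \<le> sqrt ((2 * (g * \<delta> + \<delta>))\<^sup>2)"
      by (intro real_sqrt_le_mono) (simp only: power_mult_distrib, simp)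
    also have "\<dots> = 2 * (g * \<delta> + \<delta>)" using \<delta> g by simp
    finally have "(sqrt (3 * (g * \<delta> + \<delta>)\<^sup>2 + \<delta>\<^sup>2) + \<delta>)\<^sup>2 \<le> ((2 * g + 3) * \<delta>)\<^sup>2"
      using \<delta>(1) by (intro power_mono) (simp add: algebra_simps, simp add: less_imp_le)
    then have "(sqrt (3 * (g * \<delta> + \<delta>)\<^sup>2 + \<delta>\<^sup>2) + \<delta>)\<^sup>2 / n \<le> ((2 * g + 3) * \<delta>)\<^sup>2 / n"
      by (rule divide_right_mono) simp
    also have "\<dots> = 2 * (2 * g + 3)\<^sup>2 * (\<sigma>\<^sup>2 * s * ln d / n)"
      unfolding power_mult_distrib \<delta>(2) by simp
    finally show ?thesis .
  qed
  have "prediction_error n d X est \<beta> w \<le> 2 * (2 * g + 3)\<^sup>2 * (\<sigma>\<^sup>2 * s * ln d / n)"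
    if "w \<in> E" "\<beta> \<in> lq_ball q d R" for w \<beta>
  proof -
    have "ip n w (\<lambda>i. fit d X a i - fit d X b i) \<le> g * \<delta> * l2_norm n (\<lambda>i. fit d X a i - fit d X b i)"
      if ab: "a \<in> C" "b \<in> C" for a b
      using dev[rule_format, OF \<open>w \<in> E\<close>, of "(a, b)" "\<lambda>_. 1"] ab by simp
    then show ?thesis using err that(2) bound by (meson order_trans)
  qed
  then show ?thesis
    using est E \<open>1 - 3 * exp (- B) < measure ?W E\<close>
    unfolding with_prob_greater_def B_def g_def by blast
qed

lemma with_prob_greater_mono:
  "with_prob_greater M p P \<Longrightarrow> p' \<le> p \<Longrightarrow> (\<And>w. P w \<Longrightarrow> P' w) \<Longrightarrow> with_prob_greater M p' P'"
  unfolding with_prob_greater_def by (meson le_less_trans)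

lemma estimator_exists: "\<exists>est. est \<in> estimators n d"
  by (rule exI[of _ "\<lambda>_. \<lambda>j\<in>{..<d}. 0"])
     (simp add: estimators_def vec_space_def space_PiM)

text \<open>Both identities unfold \<open>s = R * t powr (- q)\<close> with
  \<open>t\<^sup>2 = \<sigma>\<^sup>2 / \<kappa>\<^sup>2 * (ln d / n)\<close>; both sides of the
  second equal \<open>\<kappa>\<^sup>2 * R * t powr (2 - q)\<close>.\<close>

lemma lq_rates:
  fixes n d :: nat and q \<sigma> \<kappa> R :: real
  assumes "0 < q" "0 < \<sigma>" "0 < \<kappa>" "0 < n" "0 < ln (real d)"
  defines "s \<equiv> R * (\<sigma> / \<kappa> * sqrt (ln d / n)) powr (- q)"
  shows "s * ln d = (\<kappa> / \<sigma>) powr q * (R * ln d powr (1 - q / 2) * n powr (q / 2))"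
    and "\<sigma>\<^sup>2 * s * ln d / n = \<kappa>\<^sup>2 * R * (\<sigma>\<^sup>2 / \<kappa>\<^sup>2 * (ln d / n)) powr (1 - q / 2)"
proof -
  define t where "t = \<sigma> / \<kappa> * sqrt (ln d / n)"
  have t: "0 < t" using assms by (simp add: t_def)
  have "sqrt (ln d / n) powr (- q) = (ln d / n) powr (- (q / 2))"
    using assms by (simp add: powr_half_sqrt[symmetric] powr_powr)
  also have "\<dots> = ln d powr (- (q / 2)) * n powr (q / 2)"
    using assms by (simp add: powr_divide powr_minus_divide)
  finally have sqrt_powr: "sqrt (ln d / n) powr (- q) = ln d powr (- (q / 2)) * n powr (q / 2)" .
  have "(\<sigma> / \<kappa>) powr (- q) = (\<kappa> / \<sigma>) powr q"
    using assms(1-3) by (simp add: powr_divide powr_minus_divide)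
  then have "t powr (- q) = (\<kappa> / \<sigma>) powr q * (ln d powr (- (q / 2)) * n powr (q / 2))"
    using assms(2-5) unfolding t_def sqrt_powr[symmetric] by (subst powr_mult) simp_all
  moreover have "ln d powr (- (q / 2)) * ln d = ln d powr (1 - q / 2)"
    using assms(5) powr_add[of "ln d" "- (q / 2)" 1] by (simp add: add.commute)
  ultimately show "s * ln d = (\<kappa> / \<sigma>) powr q * (R * ln d powr (1 - q / 2) * n powr (q / 2))"
    unfolding s_def t_def[symmetric] by (simp add: mult_ac)
  have t2: "\<sigma>\<^sup>2 / \<kappa>\<^sup>2 * (ln d / n) = t\<^sup>2"
    using assms by (simp add: t_def power_mult_distrib power_divide)
  have "t\<^sup>2 powr (1 - q / 2) = t powr (2 * (1 - q / 2))"
    using t by (simp add: powr_powr flip: powr_numeral)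
  also have "\<dots> = t powr (2 + (- q))" by (simp add: algebra_simps)
  also have "\<dots> = t\<^sup>2 * t powr (- q)" unfolding powr_add using t by simp
  finally have "\<kappa>\<^sup>2 * R * (\<sigma>\<^sup>2 / \<kappa>\<^sup>2 * (ln d / n)) powr (1 - q / 2) = (\<kappa>\<^sup>2 * t\<^sup>2) * s"
    unfolding t2 s_def t_def[symmetric] by (simp add: mult_ac)
  also have "\<kappa>\<^sup>2 * t\<^sup>2 = \<sigma>\<^sup>2 * (ln d / n)" using assms unfolding t2[symmetric] by simp
  finally show "\<sigma>\<^sup>2 * s * ln d / n = \<kappa>\<^sup>2 * R * (\<sigma>\<^sup>2 / \<kappa>\<^sup>2 * (ln d / n)) powr (1 - q / 2)"
    by (simp add: mult_ac)
qed

text \<open>The growth condition bounds \<open>R n * real n powr (q / 2)\<close> by a constant times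
  \<open>real (d n) powr (1 - \<kappa>)\<close>. For large \<open>d n\<close> this ensures the
  \<open>s \<le> d\<close> of the entropy bound; as \<open>d n\<close> need not tend to infinity,
  values below a threshold are treated separately at each \<open>n\<close>.\<close>

lemma lq_minimax_upper_bound:
  fixes q :: real
  assumes q: "0 < q" "q \<le> 1"
  shows "\<exists>c\<^sub>2\<^sub>q>0.
         \<forall>(\<sigma>::real) (\<kappa>\<^sub>c::real) (\<kappa>::real) (d :: nat \<Rightarrow> nat) (R :: nat \<Rightarrow> real).
           0 < \<sigma> \<longrightarrow> 0 < \<kappa>\<^sub>c \<longrightarrow> 0 < \<kappa> \<longrightarrow> (\<forall>n. 0 < d n) \<longrightarrow> (\<forall>n. 0 < R n) \<longrightarrow>
           (\<lambda>n. real (d n) / (R n * real n powr (q / 2))) \<in> \<Omega>(\<lambda>n. real (d n) powr \<kappa>) \<longrightarrow>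
           (\<exists>c\<^sub>1>0. \<exists>c\<^sub>2>0. \<forall>\<^sub>F n in sequentially.
             \<forall>X\<in>space (mat_space n (d n)). column_normalized n (d n) \<kappa>\<^sub>c X \<longrightarrow>
               (\<exists>est\<in>estimators n (d n).
                 with_prob_greater (gaussian_noise n \<sigma>)
                   (1 - c\<^sub>1 * exp (- c\<^sub>2 * R n * ln (real (d n)) powr (1 - q / 2) * real n powr (q / 2)))
                   (\<lambda>w. \<forall>\<beta>\<in>lq_ball q (d n) (R n).
                      prediction_error n (d n) X est \<beta> w
                        \<le> c\<^sub>2\<^sub>q * \<kappa>\<^sub>c\<^sup>2 * R n *
                          (\<sigma>\<^sup>2 / \<kappa>\<^sub>c\<^sup>2 * (ln (real (d n)) / real n)) powr (1 - q / 2))))"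
proof -
  define K where "K = 2 * (2 * sqrt (8 * (2 + 1 / q)) + 3)\<^sup>2"
  have "0 \<le> sqrt (8 * (2 + 1 / q))" using q by simp
  then have K: "0 < K" unfolding K_def by (intro mult_pos_pos zero_less_power) linarith+
  show ?thesis
  proof (rule exI[of _ K], intro conjI K allI impI)
    fix \<sigma> \<kappa>\<^sub>c \<kappa> :: real and d :: "nat \<Rightarrow> nat" and R :: "nat \<Rightarrow> real"
    assume pos: "0 < \<sigma>" "0 < \<kappa>\<^sub>c" "0 < \<kappa>" and dpos: "\<forall>n. 0 < d n" and Rpos: "\<forall>n. 0 < R n"
      and "(\<lambda>n. real (d n) / (R n * real n powr (q / 2))) \<in> \<Omega>(\<lambda>n. real (d n) powr \<kappa>)"
    then obtain c0 where c0: "0 < c0"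
      and ev: "\<forall>\<^sub>F n in sequentially. norm (real (d n) / (R n * real n powr (q / 2))) \<ge> c0 * norm (real (d n) powr \<kappa>)"
      by (elim landau_omega.bigE)
    define r where "r = (\<kappa>\<^sub>c / \<sigma>) powr q"
    have r: "0 < r" using pos by (simp add: r_def)
    \<comment> \<open>The 5 is required by \<open>lq_ball_estimation\<close>; the other term ensures
      \<open>r \<le> c0 * real (d n) powr \<kappa>\<close>, which leads to \<open>s \<le> d\<close>.
      The rate \<open>c2\<close> below reproduces the exponent there through
      \<open>s * ln d = r * M\<close>.\<close>
    define D where "D = max 5 ((r / c0) powr (1 / \<kappa>))"
    define c2 where "c2 = 2 * (2 + 1 / q) * r"
    have c2: "0 < c2" using q r by (simp add: c2_def add_pos_pos)
    \<comment> \<open>Below the threshold \<open>M\<close> is at most \<open>D\<^sup>2 / c0\<close>,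
      so the first summand makes the probability claim trivial; the summand 3 serves the instances
      above it.\<close>
    define c1 where "c1 = exp (c2 * (D\<^sup>2 / c0)) + 3"
    have c1: "0 < c1" "3 \<le> c1" by (simp_all add: c1_def add_pos_pos)
    show "\<exists>c\<^sub>1>0. \<exists>c\<^sub>2>0. \<forall>\<^sub>F n in sequentially.
             \<forall>X\<in>space (mat_space n (d n)). column_normalized n (d n) \<kappa>\<^sub>c X \<longrightarrow>
               (\<exists>est\<in>estimators n (d n).
                 with_prob_greater (gaussian_noise n \<sigma>)
                   (1 - c\<^sub>1 * exp (- c\<^sub>2 * R n * ln (real (d n)) powr (1 - q / 2) * real n powr (q / 2)))
                   (\<lambda>w. \<forall>\<beta>\<in>lq_ball q (d n) (R n).
                      prediction_error n (d n) X est \<beta> w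
                        \<le> K * \<kappa>\<^sub>c\<^sup>2 * R n *
                          (\<sigma>\<^sup>2 / \<kappa>\<^sub>c\<^sup>2 * (ln (real (d n)) / real n)) powr (1 - q / 2)))"
    proof (rule exI[of _ c1], rule conjI[OF c1(1)], rule exI[of _ c2], rule conjI[OF c2])
      show "\<forall>\<^sub>F n in sequentially.
             \<forall>X\<in>space (mat_space n (d n)). column_normalized n (d n) \<kappa>\<^sub>c X \<longrightarrow>
               (\<exists>est\<in>estimators n (d n).
                 with_prob_greater (gaussian_noise n \<sigma>)
                   (1 - c1 * exp (- c2 * R n * ln (real (d n)) powr (1 - q / 2) * real n powr (q / 2)))
                   (\<lambda>w. \<forall>\<beta>\<in>lq_ball q (d n) (R n).
                      prediction_error n (d n) X est \<beta> w
                        \<le> K * \<kappa>\<^sub>c\<^sup>2 * R n *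
                          (\<sigma>\<^sup>2 / \<kappa>\<^sub>c\<^sup>2 * (ln (real (d n)) / real n)) powr (1 - q / 2)))"
        using ev eventually_gt_at_top[of 0]
      proof eventually_elim
        case (elim n)
        define M where "M = R n * ln (real (d n)) powr (1 - q / 2) * real n powr (q / 2)"
        have d1: "1 \<le> real (d n)" using dpos[rule_format, of n] by linarith
        have Rn: "0 < R n * real n powr (q / 2)" using Rpos elim(2) by simp
        have "c0 * real (d n) powr \<kappa> \<le> real (d n) / (R n * real n powr (q / 2))"
          using elim(1) Rn d1 by simp
        then have size: "c0 * real (d n) powr \<kappa> * (R n * real n powr (q / 2)) \<le> real (d n)"
          using Rn by (simp add: pos_le_divide_eq)
        show ?case
        proof (intro ballI impI)
          fix X assume X: "column_normalized n (d n) \<kappa>\<^sub>c X"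
          have expo: "- c2 * R n * ln (real (d n)) powr (1 - q / 2) * real n powr (q / 2) = - (c2 * M)"
            by (simp add: M_def mult_ac)
          show "\<exists>est\<in>estimators n (d n).
                 with_prob_greater (gaussian_noise n \<sigma>)
                   (1 - c1 * exp (- c2 * R n * ln (real (d n)) powr (1 - q / 2) * real n powr (q / 2)))
                   (\<lambda>w. \<forall>\<beta>\<in>lq_ball q (d n) (R n).
                      prediction_error n (d n) X est \<beta> w
                        \<le> K * \<kappa>\<^sub>c\<^sup>2 * R n *
                          (\<sigma>\<^sup>2 / \<kappa>\<^sub>c\<^sup>2 * (ln (real (d n)) / real n)) powr (1 - q / 2))"
          proof (cases "real (d n) < D")
            case True
            have "c0 * (R n * real n powr (q / 2)) \<le> c0 * real (d n) powr \<kappa> * (R n * real n powr (q / 2))"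
              using ge_one_powr_ge_zero[OF d1, of \<kappa>] pos c0 Rn by (intro mult_right_mono) auto
            then have 1: "c0 * (R n * real n powr (q / 2)) \<le> real (d n)" using size by linarith
            have "ln (real (d n)) powr (1 - q / 2) \<le> real (d n) powr (1 - q / 2)"
              using d1 q ln_le_minus_one[of "real (d n)"] by (intro powr_mono2) auto
            also have "\<dots> \<le> real (d n) powr 1" using d1 q by (intro powr_mono) auto
            finally have 2: "ln (real (d n)) powr (1 - q / 2) \<le> real (d n)" using d1 by simp
            have "c0 * M = (c0 * (R n * real n powr (q / 2))) * ln (real (d n)) powr (1 - q / 2)"
              by (simp add: M_def mult_ac)
            also have "\<dots> \<le> real (d n) * real (d n)"
              using 1 2 by (intro mult_mono) auto
            also have "\<dots> \<le> D * D" using True d1 by (intro mult_mono) auto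
            finally have "M \<le> D\<^sup>2 / c0" using c0 by (simp add: pos_le_divide_eq power2_eq_square mult.commute)
            then have "exp (c2 * M) \<le> exp (c2 * (D\<^sup>2 / c0))"
              using c2 by (intro exp_le_cancel_iff[THEN iffD2] mult_left_mono) auto
            then have "exp (c2 * M) < c1" unfolding c1_def by linarith
            then have "1 - c1 * exp (- (c2 * M)) < 0" by (simp add: exp_minus field_simps)
            \<comment> \<open>The probability demanded is negative, so the empty event
              suffices.\<close>
            then have "with_prob_greater (gaussian_noise n \<sigma>) (1 - c1 * exp (- (c2 * M))) P" for P
              unfolding with_prob_greater_def by (intro bexI[of _ "{}"]) auto
            then show ?thesis using estimator_exists unfolding expo by blast
          next
            case False
            then have d: "5 \<le> real (d n)" "(r / c0) powr (1 / \<kappa>) \<le> real (d n)" by (simp_all add: D_def)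
            have "exp (1::real) \<le> real (d n)" using exp_le d(1) by linarith
            then have ln1: "1 \<le> ln (real (d n))" using d(1) by (simp add: ln_ge_iff)
            define s where "s = R n * (\<sigma> / \<kappa>\<^sub>c * sqrt (ln (real (d n)) / real n)) powr (- q)"
            have rates: "s * ln (real (d n)) = r * M"
              "\<sigma>\<^sup>2 * s * ln (real (d n)) / n = \<kappa>\<^sub>c\<^sup>2 * R n * (\<sigma>\<^sup>2 / \<kappa>\<^sub>c\<^sup>2 * (ln (real (d n)) / n)) powr (1 - q / 2)"
              using lq_rates[OF q(1) pos(1,2) elim(2), of "d n" "R n"] ln1 unfolding s_def r_def M_def by simp_all
            have "((r / c0) powr (1 / \<kappa>)) powr \<kappa> \<le> real (d n) powr \<kappa>"
              using d(2) pos(3) by (intro powr_mono2) auto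
            then have "r / c0 \<le> real (d n) powr \<kappa>" using pos(3) r c0 by (simp add: powr_powr)
            then have "r \<le> c0 * real (d n) powr \<kappa>" using c0 by (simp add: pos_divide_le_eq mult.commute)
            then have "r * (R n * real n powr (q / 2)) \<le> c0 * real (d n) powr \<kappa> * (R n * real n powr (q / 2))"
              using Rn by (intro mult_right_mono) auto
            then have small: "r * (R n * real n powr (q / 2)) \<le> real (d n)" using size by linarith
            have "ln (real (d n)) powr (1 - q / 2) \<le> ln (real (d n)) powr 1"
              using ln1 q by (intro powr_mono) auto
            then have "r * (R n * real n powr (q / 2)) * ln (real (d n)) powr (1 - q / 2)
                \<le> real (d n) * ln (real (d n))"
              using small ln1 by (intro mult_mono) auto
            then have "s * ln (real (d n)) \<le> real (d n) * ln (real (d n))"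
              unfolding rates(1) M_def by (simp add: mult_ac)
            then have "s \<le> real (d n)" using ln1 by simp
            then obtain est where est: "est \<in> estimators n (d n)"
              and prob: "with_prob_greater (gaussian_noise n \<sigma>)
                (1 - 3 * exp (- (2 * (2 + 1 / q) * (s * ln (real (d n))))))
                (\<lambda>w. \<forall>\<beta>\<in>lq_ball q (d n) (R n). prediction_error n (d n) X est \<beta> w
                  \<le> K * (\<sigma>\<^sup>2 * s * ln (real (d n)) / n))"
              using lq_ball_estimation[OF q pos(1,2) elim(2) Rpos[rule_format, of n], of "d n" X] d(1) X
              unfolding s_def K_def by auto
            have e: "2 * (2 + 1 / q) * (s * ln (real (d n))) = c2 * M"
              unfolding rates(1) c2_def by simp
            have "3 * exp (- (c2 * M)) \<le> c1 * exp (- (c2 * M))" using c1 by simp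
            then have p_le: "1 - c1 * exp (- (c2 * M)) \<le> 1 - 3 * exp (- (c2 * M))" by linarith
            have "with_prob_greater (gaussian_noise n \<sigma>) (1 - c1 * exp (- (c2 * M)))
                (\<lambda>w. \<forall>\<beta>\<in>lq_ball q (d n) (R n). prediction_error n (d n) X est \<beta> w
                  \<le> K * \<kappa>\<^sub>c\<^sup>2 * R n * (\<sigma>\<^sup>2 / \<kappa>\<^sub>c\<^sup>2 * (ln (real (d n)) / n)) powr (1 - q / 2))"
              by (rule with_prob_greater_mono[OF prob[unfolded e rates(2)] p_le]) (simp add: mult.assoc)
            then show ?thesis using est unfolding expo by blast
          qed
        qed
      qed
    qed
  qed
qed

subsection \<open>Exact sparsity\<close>

lemma fit_on_support:
  assumes "S \<subseteq> {..<d}" "\<And>j. j < d \<Longrightarrow> j \<notin> S \<Longrightarrow> \<beta> j = 0"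
  shows "fit d X \<beta> i = (\<Sum>j\<in>S. \<beta> j * X (i, j))"
  unfolding fit_def
  by (rule sum.mono_neutral_cong_right) (use assms in \<open>auto simp: mult.commute\<close>)

text \<open>The number 163/8 is 243/8 - 10, the surplus of the deviation exponent over the claimed
  one for least squares. The logarithm is bounded below by \<open>1 - 1 / x\<close> up to 27 and by
  comparison with \<open>ln 128\<close> beyond, which leaves quadratic inequalities in
  \<open>x\<close>.\<close>

lemma ln_ratio_bound:
  fixes x :: real
  assumes "21 / 20 \<le> x" "x < 128"
  shows "x * ln 2 < 163 / 8 * ln x"
proof (cases "x \<le> 27")
  case True
  have "1 - 1 / x \<le> ln x"
    using ln_le_minus_one[of "1 / x"] assms(1) by (simp add: ln_div)
  then have ln_x: "x - 1 \<le> x * ln x" using assms(1) by (simp add: field_simps)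
  \<comment> \<open>On an interval the square lies below its chord, which reduces the quadratic
    inequality to a linear one. The same device is used on the other range.\<close>
  have "(x - 21 / 20) * (27 - x) \<ge> 0" using True assms by simp
  then have "x\<^sup>2 \<le> 561 / 20 * x - 567 / 20" by (simp add: field_simps power2_eq_square)
  then have "x\<^sup>2 * ln 2 \<le> x\<^sup>2 * (25 / 36)" "x\<^sup>2 * (25 / 36) < 163 / 8 * (x - 1)"
    using ln2_le_25_over_36 assms(1) by (auto intro!: mult_left_mono)
  then have "x * (x * ln 2) < x * (163 / 8 * ln x)"
    using ln_x by (simp add: power2_eq_square mult_ac)
  then show ?thesis using assms(1) by simp
next
  case False
  have "ln (128 / x) \<le> 128 / x - 1" using assms False by (intro ln_le_minus_one) auto
  moreover have "ln (128 :: real) = 7 * ln 2" using ln_realpow[of 2 7] by simp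
  ultimately have "7 * ln 2 + 1 - 128 / x \<le> ln x" using False by (simp add: ln_div)
  then have "x * (7 * ln 2 + 1 - 128 / x) \<le> x * ln x" using False by (intro mult_left_mono) auto
  then have ln_x: "7 * (x * ln 2) + x - 128 \<le> x * ln x" using False by (simp add: algebra_simps)
  have "(x - 27) * (128 - x) \<ge> 0" using False assms by simp
  then have "x\<^sup>2 \<le> 155 * x - 3456" by (simp add: algebra_simps power2_eq_square)
  then have quad: "x\<^sup>2 * (2 / 3) < 163 / 8 * (7 * (x * (2 / 3)) + x - 128)" using False by simp
  \<comment> \<open>In the quadratic inequality \<open>ln 2\<close> has net coefficient
    \<open>(163 / 8 * 7 - x) * x\<close> in favour of the claim, nonnegative up to 128, so
    \<open>ln 2\<close> may be lowered to 2/3.\<close>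
  have "(163 / 8 * 7 - x) * x * (ln 2 - 2 / 3) \<ge> 0"
    using assms False ln2_ge_two_thirds by (intro mult_nonneg_nonneg) auto
  then have "x\<^sup>2 * ln 2 - x\<^sup>2 * (2 / 3) \<le> 163 / 8 * (7 * (x * ln 2)) - 163 / 8 * (7 * (x * (2 / 3)))"
    by (simp add: field_simps power2_eq_square)
  then have "x\<^sup>2 * ln 2 < 163 / 8 * (7 * (x * ln 2) + x - 128)" using quad by simp
  then have "x * (x * ln 2) < x * (163 / 8 * ln x)"
    using ln_x by (simp add: power2_eq_square mult_ac)
  then show ?thesis using False by simp
qed

text \<open>The least squares error \<open>D\<close> lies in the column space and satisfies
  \<open>(l2_norm n D)\<^sup>2 = ip n w D\<close>, so the deviation on that space controls it. The
  dimension costs a factor \<open>2 ^ d\<close>, affordable while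
  \<open>d < 128 * s\<close>.\<close>

lemma l0_estimation_moderate:
  fixes n d s :: nat and \<sigma> :: real
  assumes "0 < n" "0 < s" "21 * s \<le> 20 * d" "d < 128 * s" "0 < \<sigma>"
  shows "\<exists>est\<in>estimators n d. with_prob_greater (gaussian_noise n \<sigma>)
      (1 - exp (- 10 * real s * ln (real d / real s)))
      (\<lambda>w. \<forall>\<beta>. prediction_error n d X est \<beta> w \<le> 81 * (\<sigma>\<^sup>2 * real s * ln (real d / real s) / real n))"
proof -
  let ?W = "gaussian_noise n \<sigma>"
  define x where "x = real d / real s"
  have x: "21 / 20 \<le> x" "x < 128" and d_eq: "real d = s * x"
    using assms by (simp_all add: x_def field_simps)
  have L: "0 < ln x" using x by simp
  \<comment> \<open>\<open>\<tau>\<^sup>2 / n\<close> is the claimed bound; with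
    \<open>v = 2\<close> the deviation exponent becomes \<open>243 / 8 * s * ln x\<close>.\<close>
  define \<tau> where "\<tau> = sqrt (81 * (\<sigma>\<^sup>2 * s * ln x))"
  have \<tau>: "0 \<le> \<tau>" "\<tau>\<^sup>2 = 81 * (\<sigma>\<^sup>2 * s * ln x)" using L by (simp_all add: \<tau>_def)
  have "\<exists>E\<in>sets ?W. 1 - card {()} * (2 ^ d * exp (- ((1 - 1 / 2\<^sup>2) / (2 * \<sigma>\<^sup>2) * \<tau>\<^sup>2))) \<le> measure ?W E
      \<and> (\<forall>w\<in>E. \<forall>u\<in>{()}. \<forall>c. ip n w (\<lambda>i. \<Sum>j<d. c j * X (i, j)) \<le> \<tau> * l2_norm n (\<lambda>i. \<Sum>j<d. c j * X (i, j)))"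
    by (rule gaussian_union_deviation) (use assms(5) \<tau>(1) in simp_all)
  then obtain E where E: "E \<in> sets ?W"
    and prob: "1 - 2 ^ d * exp (- ((1 - 1 / 2\<^sup>2) / (2 * \<sigma>\<^sup>2) * \<tau>\<^sup>2)) \<le> measure ?W E"
    and dev: "\<And>w \<beta>. w \<in> E \<Longrightarrow> ip n w (fit d X \<beta>) \<le> \<tau> * l2_norm n (fit d X \<beta>)"
    by (auto simp: fit_def[abs_def] mult.commute)
  have "(2::real) ^ d * exp (- ((1 - 1 / 2\<^sup>2) / (2 * \<sigma>\<^sup>2) * \<tau>\<^sup>2)) = exp (s * (x * ln 2 - 243 / 8 * ln x))"
  proof -
    have "(2::real) ^ d = exp (s * (x * ln 2))"
      by (simp add: d_eq[symmetric] mult.assoc[symmetric] exp_of_nat_mult)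
    moreover have "(1 - 1 / 2\<^sup>2) / (2 * \<sigma>\<^sup>2) * \<tau>\<^sup>2 = s * (243 / 8 * ln x)"
      unfolding \<tau>(2) using assms(5) by (simp add: field_simps)
    ultimately show ?thesis by (simp add: exp_add[symmetric] right_diff_distrib)
  qed
  also have "\<dots> < exp (s * (- 10 * ln x))"
  proof -
    have "x * ln 2 - 243 / 8 * ln x < - 10 * ln x" using ln_ratio_bound[OF x] by simp
    then show ?thesis using assms(2) by (intro exp_less_mono mult_strict_left_mono) auto
  qed
  finally have "1 - exp (- 10 * real s * ln x) < measure ?W E" using prob by (simp add: mult_ac)
  moreover obtain g where g: "g \<in> measurable (vec_space n) (vec_space d)"
    and orth: "\<And>y \<delta>. ip n (\<lambda>i. y i - fit d X (g y) i) (fit d X \<delta>) = 0"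
    using least_squares_exists[of n d X] by blast
  moreover have "prediction_error n d X (\<lambda>yX. g (fst yX)) \<beta> w \<le> 81 * (\<sigma>\<^sup>2 * s * ln x / n)"
    if w: "w \<in> E" for \<beta> w
  proof -
    define y where "y = vec_plus n (mat_vec n d X \<beta>) w"
    define D where "D = fit d X (\<lambda>j. g y j - \<beta> j)"
    have D: "D i = fit d X (g y) i - fit d X \<beta> i" for i by (simp add: D_def fit_diff)
    have "ip n (\<lambda>i. y i - fit d X (g y) i) D = ip n (\<lambda>i. w i - D i) D"
      by (rule ip_cong) (simp_all add: D y_def vec_plus_def mat_vec_def fit_def)
    then have "(l2_norm n D)\<^sup>2 = ip n w D"
      using orth[of y "\<lambda>j. g y j - \<beta> j"] by (simp add: D_def[symmetric] ip_diff_left ip_self)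
    also have "\<dots> \<le> \<tau> * l2_norm n D" unfolding D_def by (rule dev[OF w])
    finally have "l2_norm n D \<le> \<tau>"
      using \<tau>(1) l2_norm_nonneg[of n D] by (cases "l2_norm n D = 0") (auto simp: power2_eq_square)
    then have "(l2_norm n D)\<^sup>2 / n \<le> \<tau>\<^sup>2 / n" by (intro divide_right_mono power_mono) auto
    then show ?thesis unfolding \<tau>(2) by (simp add: prediction_error_eq y_def[symmetric] D[symmetric])
  qed
  ultimately show ?thesis
    using E estimatorI[OF g] unfolding with_prob_greater_def x_def[symmetric] by blast
qed

section \<open>Sparse candidates and their union bound\<close>

lemma binomial_le_exp:
  assumes "0 < k"
  shows "real (d choose k) \<le> (exp 1 * d / k) ^ k"
proof -
  \<comment> \<open>One term of the exponential series bounds the factorial of \<open>k\<close> from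
    below by \<open>k ^ k * exp (- k)\<close>.\<close>
  have "(\<Sum>i\<in>{k}. inverse (fact i) * real k ^ i) \<le> (\<Sum>i. inverse (fact i) * real k ^ i)"
    using summable_exp[of "real k"] by (intro sum_le_suminf) auto
  also have "\<dots> = exp (real k)" by (simp add: exp_def)
  finally have "inverse (fact k) * real k ^ k \<le> exp (real k)" by simp
  then have "real k ^ k \<le> exp (real k) * fact k" by (simp add: field_simps)
  moreover have "real (d choose k) * fact k \<le> real d ^ k"
    using binomial_fact_pow[of d k] by (metis of_nat_fact of_nat_le_iff of_nat_mult of_nat_power)
  ultimately have "real (d choose k) * fact k * real k ^ k \<le> real d ^ k * (exp (real k) * fact k)"
    by (intro mult_mono) auto
  then have "real (d choose k) * real k ^ k \<le> real d ^ k * exp (real k)" by (simp add: field_simps)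
  then show ?thesis
    using assms exp_of_nat_mult[of k "1::real"]
    by (simp add: power_divide power_mult_distrib pos_le_divide_eq mult.commute)
qed

text \<open>Coordinates equal to 0 stay 0 under the rational approximation, so the support does not
  grow.\<close>

lemma rational_l0_dense:
  assumes "\<beta> \<in> l0_ball d s" "0 < \<delta>"
  shows "\<exists>a\<in>l0_ball d s \<inter> PiE {..<d} (\<lambda>_. \<rat>). l2_norm n (\<lambda>i. fit d X \<beta> i - fit d X a i) \<le> \<delta>"
proof -
  define T where "T = (\<Sum>i<n. \<Sum>j<d. \<bar>X (i, j)\<bar>)"
  have T: "0 \<le> T" unfolding T_def by (intro sum_nonneg) auto
  \<comment> \<open>\<open>T + 1\<close> avoids division by zero for a vanishing matrix.\<close>
  define \<epsilon> where "\<epsilon> = \<delta> / (T + 1)"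
  have \<epsilon>: "0 < \<epsilon>" using T assms(2) by (simp add: \<epsilon>_def)
  have "\<exists>r\<in>\<rat>. \<bar>\<beta> j - r\<bar> \<le> \<epsilon> \<and> (\<beta> j = 0 \<longrightarrow> r = 0)" for j
  proof (cases "\<beta> j = 0")
    case True
    then show ?thesis using \<epsilon> by (intro bexI[of _ 0]) auto
  next
    case False
    then show ?thesis using Rats_dense_in_real[of "\<beta> j" "\<beta> j + \<epsilon>"] \<epsilon> by force
  qed
  then obtain r where r: "\<And>j. r j \<in> \<rat>" "\<And>j. \<bar>\<beta> j - r j\<bar> \<le> \<epsilon>" "\<And>j. \<beta> j = 0 \<Longrightarrow> r j = 0" by metis
  define a where "a = (\<lambda>j\<in>{..<d}. r j)"
  have "(\<Sum>j<d. of_bool (a j \<noteq> 0)) \<le> (\<Sum>j<d. of_bool (\<beta> j \<noteq> 0) :: nat)"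
    using r(3) by (intro sum_mono) (auto simp: a_def)
  also have "\<dots> \<le> s" using assms(1) by (simp only: l0_ball_def mem_Collect_eq)
  finally have "(\<Sum>j<d. of_bool (a j \<noteq> 0)) \<le> s" .
  moreover have "a \<in> PiE {..<d} (\<lambda>_. \<rat>)" "a \<in> space (vec_space d)"
    using r(1) by (simp_all add: a_def vec_space_def space_PiM)
  ultimately have "a \<in> l0_ball d s \<inter> PiE {..<d} (\<lambda>_. \<rat>)"
    unfolding l0_ball_def by blast
  moreover have "l2_norm n (\<lambda>i. fit d X \<beta> i - fit d X a i) \<le> \<delta>"
  proof -
    have "l2_norm n (\<lambda>i. fit d X \<beta> i - fit d X a i) \<le> (\<Sum>i<n. \<bar>fit d X \<beta> i - fit d X a i\<bar>)"
      unfolding l2_norm_def by (rule L2_set_le_sum_abs)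
    also have "\<dots> \<le> (\<Sum>i<n. \<Sum>j<d. \<bar>X (i, j)\<bar> * \<epsilon>)"
    proof (rule sum_mono)
      fix i
      have "\<bar>fit d X \<beta> i - fit d X a i\<bar> = \<bar>fit d X (\<lambda>j. \<beta> j - a j) i\<bar>" by (simp only: fit_diff)
      also have "\<dots> \<le> (\<Sum>j<d. \<bar>X (i, j) * (\<beta> j - a j)\<bar>)" unfolding fit_def by (rule sum_abs)
      also have "\<dots> \<le> (\<Sum>j<d. \<bar>X (i, j)\<bar> * \<epsilon>)"
        using r(2) by (intro sum_mono) (auto simp: abs_mult a_def intro!: mult_left_mono)
      finally show "\<bar>fit d X \<beta> i - fit d X a i\<bar> \<le> (\<Sum>j<d. \<bar>X (i, j)\<bar> * \<epsilon>)" .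
    qed
    also have "\<dots> = T * \<epsilon>" by (simp add: T_def sum_distrib_right)
    also have "\<dots> \<le> \<delta>" using T assms(2) by (simp add: \<epsilon>_def field_simps)
    finally show ?thesis .
  qed
  ultimately show ?thesis by blast
qed

text \<open>Differences of candidates are supported on \<open>2 * s\<close> columns, so the union
  runs over column sets of that size, at an entropy cost of about \<open>2 * s * L\<close>. With the
  claimed \<open>10 * s * L\<close> the deviation exponent must exceed \<open>12 * s * L\<close>,
  while the radius, about \<surd>3 times \<tau>, must stay below \<open>9 * b\<close>.\<close>

lemma l0_estimation_sparse:
  fixes n d s :: nat and \<sigma> :: real
  assumes "0 < n" "0 < s" "128 * s \<le> d" "0 < \<sigma>"
  shows "\<exists>est\<in>estimators n d. with_prob_greater (gaussian_noise n \<sigma>)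
      (1 - exp (- 10 * real s * ln (real d / real s)))
      (\<lambda>w. \<forall>\<beta>\<in>l0_ball d s. prediction_error n d X est \<beta> w
         \<le> 81 * (\<sigma>\<^sup>2 * real s * ln (real d / real s) / real n))"
proof -
  let ?W = "gaussian_noise n \<sigma>"
  define L where "L = ln (real d / real s)"
  have "ln (128 :: real) \<le> L"
    using assms(2,3) unfolding L_def by (subst ln_le_cancel_iff) (simp_all add: field_simps)
  moreover have "ln (128 :: real) = 7 * ln 2" using ln_realpow[of 2 7] by simp
  ultimately have L: "7 * ln 2 \<le> L" by simp
  then have Lpos: "0 < L" using ln2_ge_two_thirds by linarith
  define b where "b = \<sigma> * sqrt (s * L)"
  have b: "0 < b" "b\<^sup>2 = \<sigma>\<^sup>2 * s * L"
    using assms Lpos by (simp_all add: b_def power_mult_distrib)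
  \<comment> \<open>The factor 259/50 meets both demands: \<surd>3 times it is below 9, and with
    \<open>v = 8\<close> the exponent \<open>63 / 128 * (259 / 50)\<^sup>2\<close> exceeds 13,
    whereas \<open>v = 2\<close> would leave it below 12. The price \<open>8 ^ (2 * s)\<close> is
    paid for by \<open>128 * s \<le> d\<close>.\<close>
  define \<tau> where "\<tau> = 259 / 50 * b"
  define C where "C = l0_ball d s \<inter> PiE {..<d} (\<lambda>_. \<rat>)"
  define I where "I = {S. S \<subseteq> {..<d} \<and> card S = 2 * s}"
  have "finite I" by (rule finite_subset[of _ "Pow {..<d}"]) (auto simp: I_def)
  have "\<exists>E\<in>sets ?W. 1 - card I * (8 ^ (2 * s) * exp (- ((1 - 1 / 8\<^sup>2) / (2 * \<sigma>\<^sup>2) * \<tau>\<^sup>2))) \<le> measure ?W E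
      \<and> (\<forall>w\<in>E. \<forall>S\<in>I. \<forall>c. ip n w (\<lambda>i. \<Sum>j\<in>S. c j * X (i, j)) \<le> \<tau> * l2_norm n (\<lambda>i. \<Sum>j\<in>S. c j * X (i, j)))"
    by (rule gaussian_union_deviation)
       (use assms(4) b(1) \<open>finite I\<close> in \<open>auto simp: I_def \<tau>_def intro: finite_subset\<close>)
  then obtain E where E: "E \<in> sets ?W"
    and prob: "1 - card I * (8 ^ (2 * s) * exp (- ((1 - 1 / 8\<^sup>2) / (2 * \<sigma>\<^sup>2) * \<tau>\<^sup>2))) \<le> measure ?W E"
    and dev: "\<And>w S c. w \<in> E \<Longrightarrow> S \<in> I \<Longrightarrow>
        ip n w (\<lambda>i. \<Sum>j\<in>S. c j * X (i, j)) \<le> \<tau> * l2_norm n (\<lambda>i. \<Sum>j\<in>S. c j * X (i, j))"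
    by blast
  have "card I = d choose (2 * s)"
    unfolding I_def using n_subsets[of "{..<d}" "2 * s"] by simp
  then have "real (card I) \<le> (exp 1 * d / (2 * s)) ^ (2 * s)"
    using binomial_le_exp[of "2 * s" d] assms(2) by simp
  also have "exp 1 * d / (2 * s) = exp (1 + L - ln 2)"
    using assms(2,3) by (simp add: exp_add exp_diff L_def)
  finally have cardI: "real (card I) \<le> exp (real s * (2 * (1 + L - ln 2)))"
    by (simp add: exp_of_nat_mult[symmetric] mult_ac)
  have "ln (8 :: real) = 3 * ln 2" using ln_realpow[of 2 3] by simp
  then have "(8::real) = exp (3 * ln 2)" by (metis exp_ln zero_less_numeral)
  then have "(8::real) ^ (2 * s) = exp (real (2 * s) * (3 * ln 2))"
    by (simp only: exp_of_nat_mult)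
  then have pow8: "(8::real) ^ (2 * s) = exp (real s * (6 * ln 2))" by (simp add: mult_ac)
  have expo: "(1 - 1 / 8\<^sup>2) / (2 * \<sigma>\<^sup>2) * \<tau>\<^sup>2 = real s * (63 / 128 * (259 / 50)\<^sup>2 * L)"
    unfolding \<tau>_def power_mult_distrib b(2) using assms(4) by (simp add: field_simps)
  have "card I * (8 ^ (2 * s) * exp (- ((1 - 1 / 8\<^sup>2) / (2 * \<sigma>\<^sup>2) * \<tau>\<^sup>2)))
      \<le> exp (real s * (2 * (1 + L - ln 2))) * (exp (real s * (6 * ln 2)) * exp (- (real s * (63 / 128 * (259 / 50)\<^sup>2 * L))))"
    unfolding pow8 expo using cardI by (intro mult_right_mono) auto
  also have "\<dots> = exp (real s * (2 * (1 + L - ln 2) + 6 * ln 2 - 63 / 128 * (259 / 50)\<^sup>2 * L))"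
    by (simp add: exp_add[symmetric] algebra_simps)
  also have "\<dots> < exp (real s * (- 10 * L))"
  proof -
    \<comment> \<open>It remains to bound \<open>2 + 4 * ln 2\<close> by the surplus over 12, times
      \<open>L\<close>; \<open>7 * ln 2 \<le> L\<close>, from 128 = 2^7, and
      \<open>2 / 3 \<le> ln 2\<close> suffice.\<close>
    have "2 * (1 + L - ln 2) + 6 * ln 2 - 63 / 128 * (259 / 50)\<^sup>2 * L < - 10 * L"
      using L ln2_ge_two_thirds by (simp add: power2_eq_square)
    then show ?thesis using assms(2) by (intro exp_less_mono mult_strict_left_mono) auto
  qed
  finally have meas: "1 - exp (- 10 * real s * L) < measure ?W E"
    using prob by (simp add: mult_ac)
  have "countable C"
    unfolding C_def by (intro countable_Int2 countable_PiE) (auto simp: countable_rat)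
  moreover have "(\<Sum>j<d. of_bool ((\<lambda>j\<in>{..<d}. 0 :: real) j \<noteq> 0)) = (0 :: nat)"
    by (intro sum.neutral) simp
  then have "(\<lambda>j\<in>{..<d}. 0) \<in> C"
    unfolding C_def l0_ball_def vec_space_def space_PiM
    by (intro IntI CollectI conjI) (simp, simp only: le0, simp)
  then have "C \<noteq> {}" by blast
  moreover have "C \<subseteq> space (vec_space d)" by (auto simp: C_def l0_ball_def)
  ultimately have "\<exists>est\<in>estimators n d. \<forall>\<beta>\<in>l0_ball d s. \<forall>w.
      (\<forall>a\<in>C. \<forall>b\<in>C. ip n w (\<lambda>i. fit d X a i - fit d X b i) \<le> \<tau> * l2_norm n (\<lambda>i. fit d X a i - fit d X b i)) \<longrightarrow>
      prediction_error n d X est \<beta> w \<le> (sqrt (3 * (\<tau> + b / 200)\<^sup>2 + b\<^sup>2 / 10) + b / 200)\<^sup>2 / real n"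
    using b(1) rational_l0_dense[of _ d s "b / 200"]
    by (intro midpoint_estimator) (simp_all add: \<tau>_def C_def)
  then obtain est where est: "est \<in> estimators n d"
    and err: "\<And>\<beta> w. \<beta> \<in> l0_ball d s \<Longrightarrow>
      (\<forall>a\<in>C. \<forall>b\<in>C. ip n w (\<lambda>i. fit d X a i - fit d X b i) \<le> \<tau> * l2_norm n (\<lambda>i. fit d X a i - fit d X b i)) \<Longrightarrow>
      prediction_error n d X est \<beta> w \<le> (sqrt (3 * (\<tau> + b / 200)\<^sup>2 + b\<^sup>2 / 10) + b / 200)\<^sup>2 / real n"
    by blast
  \<comment> \<open>The resolution \<open>b / 200\<close> and the slack
    \<open>b\<^sup>2 / 10\<close> are small enough for the radius to be at most
    \<open>899 / 100 * b\<close>; adding the resolution stays below \<open>9 * b\<close>, whose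
    square gives the constant 81.\<close>
  have "3 * (\<tau> + b / 200)\<^sup>2 + b\<^sup>2 / 10 \<le> (899 / 100 * b)\<^sup>2"
    by (simp add: \<tau>_def power2_eq_square algebra_simps)
  then have "sqrt (3 * (\<tau> + b / 200)\<^sup>2 + b\<^sup>2 / 10) \<le> 899 / 100 * b"
    using b(1) by (intro real_le_lsqrt) auto
  then have "(sqrt (3 * (\<tau> + b / 200)\<^sup>2 + b\<^sup>2 / 10) + b / 200)\<^sup>2 \<le> (9 * b)\<^sup>2"
    using b(1) by (intro power_mono) auto
  then have bound: "(sqrt (3 * (\<tau> + b / 200)\<^sup>2 + b\<^sup>2 / 10) + b / 200)\<^sup>2 / n \<le> 81 * (\<sigma>\<^sup>2 * s * L / n)"
    using divide_right_mono[of _ "(9 * b)\<^sup>2" "real n"] unfolding power_mult_distrib b(2) by simp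
  have "prediction_error n d X est \<beta> w \<le> 81 * (\<sigma>\<^sup>2 * s * L / n)"
    if w: "w \<in> E" and \<beta>: "\<beta> \<in> l0_ball d s" for \<beta> w
  proof (rule order_trans[OF err[OF \<beta>] bound], intro ballI)
    fix a a' assume aa': "a \<in> C" "a' \<in> C"
    define A where "A = {j. j < d \<and> (a j \<noteq> 0 \<or> a' j \<noteq> 0)}"
    have supp: "card {j. j < d \<and> c j \<noteq> 0} \<le> s" if "c \<in> C" for c
    proof -
      have "{..<d} \<inter> {j. c j \<noteq> 0} = {j. j < d \<and> c j \<noteq> 0}" by auto
      then show ?thesis using that by (simp add: C_def l0_ball_def sum.If_cases of_bool_def)
    qed
    have "A = {j. j < d \<and> a j \<noteq> 0} \<union> {j. j < d \<and> a' j \<noteq> 0}" by (auto simp: A_def)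
    then have "card A \<le> 2 * s"
      using card_Un_le[of "{j. j < d \<and> a j \<noteq> 0}" "{j. j < d \<and> a' j \<noteq> 0}"] supp[OF aa'(1)] supp[OF aa'(2)]
      by simp
    \<comment> \<open>\<open>I\<close> contains only sets of exactly \<open>2 * s\<close> columns,
      so the joint support is padded to that size; \<open>128 * s \<le> d\<close> leaves room for
      it.\<close>
    then obtain S where S: "A \<subseteq> S" "S \<subseteq> {..<d}" "card S = 2 * s"
      using exists_subset_between[of A "2 * s" "{..<d}"] assms(3) by (auto simp: A_def)
    have "fit d X a i - fit d X a' i = (\<Sum>j\<in>S. (a j - a' j) * X (i, j))" for i
      unfolding fit_diff[symmetric]
      by (rule fit_on_support[OF S(2)]) (use S(1) in \<open>auto simp: A_def\<close>)
    then show "ip n w (\<lambda>i. fit d X a i - fit d X a' i) \<le> \<tau> * l2_norm n (\<lambda>i. fit d X a i - fit d X a' i)"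
      using dev[OF w, of S "\<lambda>j. a j - a' j"] S(2,3) by (simp add: I_def)
  qed
  then show ?thesis
    using est E meas unfolding with_prob_greater_def L_def by blast
qed

theorem theorem4:
  shows
    "(\<forall>q::real. 0 < q \<and> q \<le> 1 \<longrightarrow>
       (\<exists>c\<^sub>2\<^sub>q>0.
         \<forall>(\<sigma>::real) (\<kappa>\<^sub>c::real) (\<kappa>::real) (d :: nat \<Rightarrow> nat) (R :: nat \<Rightarrow> real).
           0 < \<sigma> \<longrightarrow> 0 < \<kappa>\<^sub>c \<longrightarrow> 0 < \<kappa> \<longrightarrow> (\<forall>n. 0 < d n) \<longrightarrow> (\<forall>n. 0 < R n) \<longrightarrow>
           (\<lambda>n. real (d n) / (R n * real n powr (q / 2))) \<in> \<Omega>(\<lambda>n. real (d n) powr \<kappa>) \<longrightarrow>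
           (\<exists>c\<^sub>1>0. \<exists>c\<^sub>2>0. \<forall>\<^sub>F n in sequentially.
             \<forall>X\<in>space (mat_space n (d n)). column_normalized n (d n) \<kappa>\<^sub>c X \<longrightarrow>
               (\<exists>est\<in>estimators n (d n).
                 with_prob_greater (gaussian_noise n \<sigma>)
                   (1 - c\<^sub>1 * exp (- c\<^sub>2 * R n * ln (real (d n)) powr (1 - q / 2) * real n powr (q / 2)))
                   (\<lambda>w. \<forall>\<beta>\<in>lq_ball q (d n) (R n).
                      prediction_error n (d n) X est \<beta> w
                        \<le> c\<^sub>2\<^sub>q * \<kappa>\<^sub>c\<^sup>2 * R n *
                          (\<sigma>\<^sup>2 / \<kappa>\<^sub>c\<^sup>2 * (ln (real (d n)) / real n)) powr (1 - q / 2))))))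
     \<and>
     (\<forall>(n::nat) (d::nat) (s::nat) (\<sigma>::real).
       0 < n \<longrightarrow> 0 < s \<longrightarrow> 21 * s \<le> 20 * d \<longrightarrow> 0 < \<sigma> \<longrightarrow>
       (\<forall>X\<in>space (mat_space n d).
         \<exists>est\<in>estimators n d.
           with_prob_greater (gaussian_noise n \<sigma>)
             (1 - exp (- 10 * real s * ln (real d / real s)))
             (\<lambda>w. \<forall>\<beta>\<in>l0_ball d s.
                prediction_error n d X est \<beta> w
                  \<le> 81 * (\<sigma>\<^sup>2 * real s * ln (real d / real s) / real n))))"
proof (intro conjI allI impI ballI)
  fix q :: real
  assume q: "0 < q \<and> q \<le> 1"
  show "\<exists>c\<^sub>2\<^sub>q>0.
         \<forall>(\<sigma>::real) (\<kappa>\<^sub>c::real) (\<kappa>::real) (d :: nat \<Rightarrow> nat) (R :: nat \<Rightarrow> real).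
           0 < \<sigma> \<longrightarrow> 0 < \<kappa>\<^sub>c \<longrightarrow> 0 < \<kappa> \<longrightarrow> (\<forall>n. 0 < d n) \<longrightarrow> (\<forall>n. 0 < R n) \<longrightarrow>
           (\<lambda>n. real (d n) / (R n * real n powr (q / 2))) \<in> \<Omega>(\<lambda>n. real (d n) powr \<kappa>) \<longrightarrow>
           (\<exists>c\<^sub>1>0. \<exists>c\<^sub>2>0. \<forall>\<^sub>F n in sequentially.
             \<forall>X\<in>space (mat_space n (d n)). column_normalized n (d n) \<kappa>\<^sub>c X \<longrightarrow>
               (\<exists>est\<in>estimators n (d n).
                 with_prob_greater (gaussian_noise n \<sigma>)
                   (1 - c\<^sub>1 * exp (- c\<^sub>2 * R n * ln (real (d n)) powr (1 - q / 2) * real n powr (q / 2)))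
                   (\<lambda>w. \<forall>\<beta>\<in>lq_ball q (d n) (R n).
                      prediction_error n (d n) X est \<beta> w
                        \<le> c\<^sub>2\<^sub>q * \<kappa>\<^sub>c\<^sup>2 * R n *
                          (\<sigma>\<^sup>2 / \<kappa>\<^sub>c\<^sup>2 * (ln (real (d n)) / real n)) powr (1 - q / 2))))"
    by (rule lq_minimax_upper_bound[OF conjunct1[OF q] conjunct2[OF q]])
next
  fix n d s :: nat and \<sigma> :: real and X
  assume pos: "0 < n" "0 < s" "21 * s \<le> 20 * d" "0 < \<sigma>"
  show "\<exists>est\<in>estimators n d.
           with_prob_greater (gaussian_noise n \<sigma>)
             (1 - exp (- 10 * real s * ln (real d / real s)))
             (\<lambda>w. \<forall>\<beta>\<in>l0_ball d s.
                prediction_error n d X est \<beta> w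
                  \<le> 81 * (\<sigma>\<^sup>2 * real s * ln (real d / real s) / real n))"
  proof (cases "d < 128 * s")
    case True
    from l0_estimation_moderate[OF pos(1-3) this pos(4), of X] show ?thesis
      by (rule bexE) (rule bexI, erule with_prob_greater_mono, auto)
  next
    case False
    then have "128 * s \<le> d" by simp
    from l0_estimation_sparse[OF pos(1,2) this pos(4), of X] show ?thesis .
  qed
qed

end
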